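(* For every integer $n\geq 2$, let $Q_n\subset\mathbb{R}^{n-1}$ be the $(n-1)$-dimensional lattice simplex which is the convex hull of the $n$ points $v_0=(1,1,\dots,1)$ and, for $m=1,\dots,n-1$, the point $v_m\in\mathbb{R}^{n-1}$ with coordinates $(v_m)_k=1$ for $k<m$, $(v_m)_m=-m$, and $(v_m)_k=0$ for $k>m$. Then: (i) $\delta(Q_n,z)=A_n(z)$, where $A_n(z)$ is the Eulerian polynomial; (ii) $Q_n$ has a regular, flag, unimodular triangulation.
   Context: For a $d$-dimensional lattice polytope $\mathcal{P}\subset\mathbb{R}^d$ and $k\in\mathbb{Z}_{>0}$, let $i(\mathcal{P},k)=\#(k\mathcal{P}\cap\mathbb{Z}^d)$. The $\delta$-polynomial $\delta(\mathcal{P},z)$ is the polynomial defined by $1+\sum_{k\geq1}i(\mathcal{P},k)z^k=\delta(\mathcal{P},z)/(1-z)^{d+1}$. The Eulerian polynomial is $A_n(z)=\sum_{\pi\in S_n} z^{\operatorname{des}(\pi)}$, where $S_n$ is the symmetric group on $\{1,\dots,n\}$ and $\operatorname{des}(\pi)=\#\{i\in\{1,\dots,n-1\} : \pi(i)>\pi(i+1)\}$ (so $A_n$ has constant term $1$ and degree $n-1$). A triangulation of a lattice polytope $\mathcal{P}$ using lattice points of $\mathcal{P}$ is unimodular if each maximal simplex has normalized volume $1$; it is regular if it is induced as the projection of the lower faces of the convex hull of the lifted points $(p,h(p))$ for some height function $h$ on the lattice points used; it is flag if every minimal non-face of the triangulation (as a simplicial complex) has exactly two elements. *)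

theory Defs
  imports
    "HOL-Analysis.Analysis"
    "HOL-Computational_Algebra.Computational_Algebra"
    "HOL-Combinatorics.Permutations"
begin

section \<open>Lattice polytopes and the delta-polynomial\<close>

definition lattice_points :: "(real ^ 'd) set" where
  "lattice_points = {x. \<forall>i. x $ i \<in> \<int>}"

definition lattice_polytope :: "(real ^ 'd::finite) set \<Rightarrow> bool" where
  "lattice_polytope P \<longleftrightarrow> (\<exists>V. finite V \<and> V \<subseteq> lattice_points \<and> P = convex hull V)"

definition ehrhart_count :: "(real ^ 'd::finite) set \<Rightarrow> nat \<Rightarrow> nat" where
  "ehrhart_count P k = card ((\<lambda>x. real k *\<^sub>R x) ` P \<inter> lattice_points)"

definition ehrhart_series :: "(real ^ 'd::finite) set \<Rightarrow> real fps" where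
  "ehrhart_series P = 1 + Abs_fps (\<lambda>k. if k \<ge> 1 then real (ehrhart_count P k) else 0)"

text \<open>
  Intended for full-dimensional lattice polytopes only: the exponent uses the dimension of the
  ambient space. The polynomial is unique whenever it exists, since \<open>fps_of_poly\<close> is injective.
\<close>
definition delta_poly :: "(real ^ 'd::finite) set \<Rightarrow> real poly" where
  "delta_poly P = (THE p. ehrhart_series P = fps_of_poly p / (1 - fps_X) ^ (CARD('d) + 1))"


section \<open>Eulerian polynomials\<close>

definition des :: "nat \<Rightarrow> (nat \<Rightarrow> nat) \<Rightarrow> nat" where
  "des n \<pi> = card {i \<in> {1..<n}. \<pi> i > \<pi> (i + 1)}"

definition eulerian_poly :: "nat \<Rightarrow> real poly" where
  "eulerian_poly n = (\<Sum>\<pi> | \<pi> permutes {1..n}. monom 1 (des n \<pi>))"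


section \<open>Triangulations\<close>

text \<open>
  A triangulation is represented by the set of all its (closed, geometric) simplices. As
  \<^const>\<open>simplicial_complex\<close> demands closure under faces, this includes the empty simplex.
\<close>

definition vertices :: "(real ^ 'd::finite) set \<Rightarrow> (real ^ 'd) set" where
  "vertices S = {v. v extreme_point_of S}"

definition vertex_set :: "(real ^ 'd::finite) set set \<Rightarrow> (real ^ 'd) set" where
  "vertex_set T = (\<Union>S\<in>T. vertices S)"

definition lattice_triangulation_of ::
    "(real ^ 'd::finite) set set \<Rightarrow> (real ^ 'd) set \<Rightarrow> bool" where
  "lattice_triangulation_of T P \<longleftrightarrow>
     simplicial_complex T \<and> \<Union>T = P \<and> vertex_set T \<subseteq> lattice_points"

text \<open>
  For a simplex in \<open>d\<close>-space, the normalized volume is \<open>d!\<close> times the Lebesgue measure. A maximal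
  simplex of dimension less than \<open>d\<close> has measure 0 and hence violates the condition.
\<close>
definition unimodular :: "(real ^ 'd::finite) set set \<Rightarrow> bool" where
  "unimodular T \<longleftrightarrow>
     (\<forall>S\<in>T. (\<forall>S'\<in>T. S \<subseteq> S' \<longrightarrow> S' = S) \<longrightarrow> fact CARD('d) * measure lebesgue S = 1)"

text \<open>
  A face of a polytope in the product with the real line is lower if no point of the polytope lies
  strictly below one of its points. The empty face is (vacuously) lower and corresponds to the
  empty simplex.
\<close>
definition lower_face_of ::
    "((real ^ 'd::finite) \<times> real) set \<Rightarrow> ((real ^ 'd) \<times> real) set \<Rightarrow> bool" where
  "lower_face_of F L \<longleftrightarrow> F face_of L \<and> (\<forall>x t s. (x, t) \<in> F \<and> s < t \<longrightarrow> (x, s) \<notin> L)"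

definition regular :: "(real ^ 'd::finite) set set \<Rightarrow> bool" where
  "regular T \<longleftrightarrow>
     (\<exists>h :: real ^ 'd \<Rightarrow> real.
        T = {fst ` F | F. lower_face_of F (convex hull ((\<lambda>p. (p, h p)) ` vertex_set T))})"

definition is_face :: "(real ^ 'd::finite) set set \<Rightarrow> (real ^ 'd) set \<Rightarrow> bool" where
  "is_face T \<sigma> \<longleftrightarrow> (\<exists>S\<in>T. \<sigma> = vertices S)"

definition minimal_nonface :: "(real ^ 'd::finite) set set \<Rightarrow> (real ^ 'd) set \<Rightarrow> bool" where
  "minimal_nonface T \<sigma> \<longleftrightarrow>
     \<sigma> \<subseteq> vertex_set T \<and> \<not> is_face T \<sigma> \<and> (\<forall>\<tau>. \<tau> \<subset> \<sigma> \<longrightarrow> is_face T \<tau>)"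

definition flag :: "(real ^ 'd::finite) set set \<Rightarrow> bool" where
  "flag T \<longleftrightarrow> (\<forall>\<sigma>. minimal_nonface T \<sigma> \<longrightarrow> card \<sigma> = 2)"


section \<open>The simplices\<close>

text \<open>
  The coordinates of \<open>real ^ 'd\<close> are numbered by \<open>c\<close>, which is meant to be a bijection from the
  index type onto \<open>{1..n - 1}\<close>; the coordinate \<open>i\<close> is then the \<open>c i\<close>-th one.
\<close>
definition Q_vertex :: "('d::finite \<Rightarrow> nat) \<Rightarrow> nat \<Rightarrow> real ^ 'd" where
  "Q_vertex c m =
     (if m = 0 then (\<chi> i. 1)
      else (\<chi> i. if c i < m then 1 else if c i = m then - real m else 0))"

definition Q :: "('d::finite \<Rightarrow> nat) \<Rightarrow> nat \<Rightarrow> (real ^ 'd) set" where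
  "Q c n = convex hull (Q_vertex c ` {0..n - 1})"

end

theory Submission
  imports Defs
begin

text \<open>
  The partial sums \<open>y\<^sub>k = (1 - x\<^sub>1) + \<dots> + (1 - x\<^sub>k)\<close> are unimodular coordinates that turn \<open>Q\<^sub>n\<close> into the
  lecture hall simplex \<open>0 \<le> y\<^sub>1 / 2 \<le> y\<^sub>2 / 3 \<le> \<dots> \<le> y\<^sub>d / (d + 1) \<le> 1\<close> with \<open>d = n - 1\<close>. Writing
  \<open>y\<^sub>d = n q - r\<close> with \<open>0 \<le> r < n\<close>, an induction on \<open>d\<close> counts \<open>(t + 1)\<^sup>n - t\<^sup>n\<close> lattice points in
  the \<open>t\<close>-th dilate. Stable sorting of the words \<open>{1..n} \<rightarrow> {0..t}\<close> yields
  \<open>\<Sum>\<^sub>t (t + 1)\<^sup>n z\<^sup>t = A\<^sub>n(z) / (1 - z)\<^bsup>n + 1\<^esup>\<close>, and the two identities give the \<open>\<delta>\<close>-polynomial.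

  The lattice points are the strictly decreasing words \<open>y\<^sub>d > y\<^bsub>d-1\<^esub> > \<dots>\<close> of positive integers padded
  by zeros. The hyperplane \<open>y\<^sub>d - y\<^bsub>d-1\<^esub> = 1\<close> cuts the simplex into a cone from the origin over
  a copy of the next smaller simplex and a chimney \<open>1 + y\<^bsub>d-1\<^esub> \<le> y\<^sub>d \<le> d + 1\<close> over the next smaller
  simplex. Iterating this gives a triangulation that is the clique complex of an explicit
  graph on the words, so flagness is built in. Two non-adjacent lattice points can always be
  exchanged for two others with the same sum and smaller total height, and a nonnegative
  combination of a clique is determined by its value. Hence the cliques are exactly the
  supports of the points on the lower hull of the lifted points, which shows at once that they
  form a triangulation and that it is regular. Finally, maximal cliques generate the lattice
  over the integers.
\<close>

no_notation fps_nth (infixl "$" 75)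


section \<open>Words coding the lattice points\<close>

text \<open>Floor of the chimney over a word: the smallest letter that may be put in front of it.
  The value 1 on \<open>[]\<close> keeps all letters positive.\<close>

fun low :: "nat list \<Rightarrow> nat" where
  "low [] = 1"
| "low (a # B) = Suc a"

fun valid :: "nat list \<Rightarrow> bool" where
  "valid [] = True"
| "valid (a # B) = (valid B \<and> low B \<le> a)"

text \<open>The letters are \<open>y_d\<close>, \<open>y_(d-1)\<close>, and so on, with trailing
  zeros cut off. The condition on \<open>low\<close> bounds the first letter by
  \<open>d + 1\<close>.\<close>

definition words :: "nat \<Rightarrow> nat list set" where
  "words d = {B. valid B \<and> length B \<le> d \<and> low B \<le> d + 2}"

definition entry :: "nat list \<Rightarrow> nat \<Rightarrow> nat" where
  "entry B i = (if i < length B then B ! i else 0)"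

text \<open>The edges of the triangulation, oriented upwards. A letter \<open>b\<close> in front of \<open>C\<close> is on the floor of the
  chimney over \<open>C\<close> iff \<open>b = low C\<close>; only there may it exceed the letter of the lower word by more
  than one, and only floor points are joined to the apex \<open>[]\<close> of the cone.\<close>

fun adj :: "nat list \<Rightarrow> nat list \<Rightarrow> bool" where
  "adj [] [] = True"
| "adj [] (b # C) = (b = low C)"
| "adj (a # B) [] = False"
| "adj (a # B) (b # C) = (adj B C \<and> a \<le> b \<and> (b \<le> Suc a \<or> b = low C))"

definition compat :: "nat list \<Rightarrow> nat list \<Rightarrow> bool" where
  "compat B C \<longleftrightarrow> adj B C \<or> adj C B"

definition column :: "nat \<Rightarrow> nat list \<Rightarrow> nat set" where
  "column d B = {low B..d + 2}"

lemma entry_Nil [simp]: "entry [] i = 0"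
  and entry_Cons_0 [simp]: "entry (a # B) 0 = a"
  and entry_Cons_Suc [simp]: "entry (a # B) (Suc i) = entry B i"
  by (auto simp: entry_def)

lemma entry_beyond: "length B \<le> i \<Longrightarrow> entry B i = 0"
  by (simp add: entry_def)

lemma low_eq_entry: "low B = Suc (entry B 0)"
  by (cases B) auto

lemma low_pos: "1 \<le> low B"
  by (cases B) auto

lemma words_0: "words 0 = {[]}"
  by (auto simp: words_def)

lemma Nil_in_words [simp]: "[] \<in> words d"
  by (simp add: words_def)

lemma Cons_in_words_iff: "x # B \<in> words (Suc d) \<longleftrightarrow> B \<in> words d \<and> x \<in> column d B"
  by (auto simp: words_def column_def)

lemma words_Suc:
  "words (Suc d) = insert [] ((\<lambda>(B, x). x # B) ` (SIGMA B:words d. column d B))"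
proof (intro set_eqI)
  fix C show "C \<in> words (Suc d) \<longleftrightarrow>
     C \<in> insert [] ((\<lambda>(B, x). x # B) ` (SIGMA B:words d. column d B))"
    by (cases C) (auto simp: Cons_in_words_iff)
qed

lemma finite_column [simp]: "finite (column d B)"
  by (simp add: column_def)

lemma finite_words [simp]: "finite (words d)"
  by (induction d) (auto simp: words_0 words_Suc)

lemma sum_words_Suc:
  fixes f :: "nat list \<Rightarrow> 'a::comm_monoid_add"
  shows "sum f (words (Suc d)) = f [] + (\<Sum>B\<in>words d. \<Sum>x\<in>column d B. f (x # B))"
proof -
  have "sum f ((\<lambda>(B, x). x # B) ` (SIGMA B:words d. column d B))
      = (\<Sum>(B, x)\<in>(SIGMA B:words d. column d B). f (x # B))"
    by (subst sum.reindex) (auto simp: inj_on_def case_prod_unfold)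
  also have "\<dots> = (\<Sum>B\<in>words d. \<Sum>x\<in>column d B. f (x # B))"
    by (rule sum.Sigma[symmetric]) auto
  finally show ?thesis
    unfolding words_Suc by (subst sum.insert) auto
qed

lemma adj_refl [simp]: "adj B B"
  by (induction B) auto

lemma compat_refl [simp]: "compat B B"
  by (simp add: compat_def)

lemma compat_commute: "compat B C \<longleftrightarrow> compat C B"
  by (auto simp: compat_def)

lemma compat_Cons: "compat (a # B) (b # C) \<Longrightarrow> compat B C"
  by (auto simp: compat_def)

lemma compat_Nil_Cons [simp]: "compat [] (b # C) \<longleftrightarrow> b = low C"
  by (simp add: compat_def)

lemma compat_Cons_Nil [simp]: "compat (b # C) [] \<longleftrightarrow> b = low C"
  by (simp add: compat_def)

lemma adj_low: "adj B C \<Longrightarrow> low B \<le> low C"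
  by (cases B; cases C) auto

text \<open>Along an edge no letter falls and, unless the ends coincide, some letter rises. So the
  letter sum ranks the words of a clique, which gives antisymmetry here and the choice of extremal
  words later.\<close>

lemma adj_sum_list: "adj B C \<Longrightarrow> sum_list B \<le> sum_list C \<and> (sum_list B = sum_list C \<longrightarrow> B = C)"
proof (induction B C rule: adj.induct)
  case (2 b C)
  then show ?case using low_pos[of C] by simp
qed auto

lemma adj_antisym: "adj B C \<Longrightarrow> adj C B \<Longrightarrow> B = C"
  using adj_sum_list[of B C] adj_sum_list[of C B] by force

section \<open>Uniqueness of nonnegative combinations of cliques\<close>

lemma Nil_coefficient:
  fixes a :: "nat list \<Rightarrow> real"
  assumes nonneg: "\<And>B. B \<in> words (Suc d) \<Longrightarrow> 0 \<le> a B"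
    and clique: "\<And>B C. B \<in> words (Suc d) \<Longrightarrow> C \<in> words (Suc d) \<Longrightarrow> 0 < a B \<Longrightarrow> 0 < a C \<Longrightarrow> compat B C"
  shows "a [] = max 0 (sum a (words (Suc d)) -
     ((\<Sum>B\<in>words (Suc d). a B * entry B 0) - (\<Sum>B\<in>words (Suc d). a B * entry B 1)))"
proof -
  \<comment> \<open>The functional 1 - (first letter - second letter) is 1 on the apex
    \<open>[]\<close> and \<open>low B - x\<close> \<le> 0 on \<open>x # B\<close>; \<open>D\<close>
    collects these losses. If the apex has positive weight, all other words of positive weight lie
    on the floor and \<open>D\<close> vanishes; otherwise the functional is \<open>- D\<close> and
    the maximum is 0.\<close>
  define D where "D = (\<Sum>B\<in>words d. \<Sum>x\<in>column d B. a (x # B) * (real x - real (low B)))"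
  have mem: "x # B \<in> words (Suc d)" if "B \<in> words d" "x \<in> column d B" for x B
    using that by (simp add: Cons_in_words_iff)
  have eq: "sum a (words (Suc d)) -
     ((\<Sum>B\<in>words (Suc d). a B * entry B 0) - (\<Sum>B\<in>words (Suc d). a B * entry B 1)) = a [] - D"
    unfolding sum_words_Suc D_def
    by (simp add: low_eq_entry sum_subtractf[symmetric] sum.distrib[symmetric] algebra_simps)
  have "0 \<le> D"
    unfolding D_def
    by (intro sum_nonneg mult_nonneg_nonneg) (auto intro!: nonneg mem simp: column_def)
  moreover have "D = 0" if "0 < a []"
    unfolding D_def
  proof (intro sum.neutral ballI)
    fix B x assume "B \<in> words d" "x \<in> column d B"
    then show "a (x # B) * (real x - real (low B)) = 0"
      using clique[of "[]" "x # B"] that nonneg[of "x # B"] mem[of B x]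
      by (cases "a (x # B) = 0") auto
  qed
  moreover have "0 \<le> a []" by (simp add: nonneg)
  ultimately show ?thesis unfolding eq by (cases "a [] = 0") auto
qed

text \<open>Each support consists of at most two consecutive integers. Equal means force the union
  of the supports to be equally short, and then mass and mean determine both weights.\<close>

lemma two_point_distribution_unique:
  fixes a b :: "nat \<Rightarrow> real"
  assumes fin: "finite I" and a0: "\<And>x. x \<in> I \<Longrightarrow> 0 \<le> a x" and b0: "\<And>x. x \<in> I \<Longrightarrow> 0 \<le> b x"
    and a1: "\<And>x y. x \<in> I \<Longrightarrow> y \<in> I \<Longrightarrow> 0 < a x \<Longrightarrow> 0 < a y \<Longrightarrow> y \<le> Suc x"
    and b1: "\<And>x y. x \<in> I \<Longrightarrow> y \<in> I \<Longrightarrow> 0 < b x \<Longrightarrow> 0 < b y \<Longrightarrow> y \<le> Suc x"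
    and mass: "sum a I = sum b I" and mean: "(\<Sum>x\<in>I. a x * x) = (\<Sum>x\<in>I. b x * x)"
    and x: "x \<in> I"
  shows "a x = b x"
proof -
  \<comment> \<open>Seen from \<open>Suc q\<close>, all weight of \<open>a\<close> lies at or above
    it, some strictly above, while all weight of \<open>b\<close> lies at or below it. So the means
    cannot agree.\<close>
  have far: False
    if h: "finite I" "\<And>x. x \<in> I \<Longrightarrow> 0 \<le> a x" "\<And>x. x \<in> I \<Longrightarrow> 0 \<le> b x"
     "\<And>x y. x \<in> I \<Longrightarrow> y \<in> I \<Longrightarrow> 0 < a x \<Longrightarrow> 0 < a y \<Longrightarrow> y \<le> Suc x"
     "\<And>x y. x \<in> I \<Longrightarrow> y \<in> I \<Longrightarrow> 0 < b x \<Longrightarrow> 0 < b y \<Longrightarrow> y \<le> Suc x"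
     "sum a I = sum b I" "(\<Sum>x\<in>I. a x * x) = (\<Sum>x\<in>I. b x * x)"
     "p \<in> I" "q \<in> I" "0 < a p" "0 < b q" "Suc q < p" for a b :: "nat \<Rightarrow> real" and p q
  proof -
    have "0 < (\<Sum>x\<in>I. a x * (real x - Suc q))"
    proof (rule sum_pos2[OF h(1) h(8)])
      show "0 < a p * (real p - real (Suc q))" using h(10,12) by simp
      fix i assume i: "i \<in> I"
      show "0 \<le> a i * (real i - real (Suc q))"
      proof (cases "a i = 0")
        case False
        then have "0 < a i" using h(2)[OF i] by simp
        then have "p \<le> Suc i" using h(4)[OF i h(8) _ h(10)] by simp
        then show ?thesis using \<open>0 < a i\<close> h(12) by simp
      qed simp
    qed
    moreover have "(\<Sum>x\<in>I. b x * (real x - Suc q)) \<le> 0"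
    proof (rule sum_nonpos)
      fix i assume i: "i \<in> I"
      show "b i * (real i - real (Suc q)) \<le> 0"
      proof (cases "b i = 0")
        case False
        then have "0 < b i" using h(3)[OF i] by simp
        then have "i \<le> Suc q" using h(5)[OF h(9) i h(11)] by simp
        then show ?thesis using \<open>0 < b i\<close> by (simp add: mult_le_0_iff)
      qed simp
    qed
    moreover have "(\<Sum>x\<in>I. a x * (real x - Suc q)) = (\<Sum>x\<in>I. b x * (real x - Suc q))"
      using h(6,7) by (simp add: right_diff_distrib sum_subtractf sum_distrib_right[symmetric])
    ultimately show False by linarith
  qed
  define U where "U = {x \<in> I. 0 < a x \<or> 0 < b x}"
  have near: "y \<le> Suc x" if "x \<in> U" "y \<in> U" for x y
    using that a1[of x y] b1[of x y] far[OF fin a0 b0 a1 b1 mass mean, of y x]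
      far[OF fin b0 a0 b1 a1 mass[symmetric] mean[symmetric], of y x]
    unfolding U_def by force
  show ?thesis
  proof (cases "x \<in> U")
    case False
    then show ?thesis using x a0[OF x] b0[OF x] by (auto simp: U_def)
  next
    case True
    have finU: "finite U" using fin by (simp add: U_def)
    define c where "c = Min U"
    have cU: "c \<in> U" and cmin: "\<And>y. y \<in> U \<Longrightarrow> c \<le> y"
      using True finU by (auto simp: c_def intro: Min_in)
    have Usub: "U \<subseteq> {c, Suc c}" using near[OF cU] cmin by force
    define f where "f y = (if y \<in> I then a y - b y else 0)" for y
    have f0: "f y = 0" if "y \<notin> U" for y
      using that a0[of y] b0[of y] by (auto simp: f_def U_def)
    have s: "(\<Sum>y\<in>I. f y * g y) = f c * g c + f (Suc c) * g (Suc c)" for g :: "nat \<Rightarrow> real"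
    proof -
      have "(\<Sum>y\<in>I. f y * g y) = (\<Sum>y\<in>U. f y * g y)"
        using fin f0 by (intro sum.mono_neutral_right) (auto simp: U_def)
      also have "\<dots> = (\<Sum>y\<in>{c, Suc c}. f y * g y)"
        using Usub f0 by (intro sum.mono_neutral_left) auto
      finally show ?thesis by simp
    qed
    have "(\<Sum>y\<in>I. f y * 1) = 0" "(\<Sum>y\<in>I. f y * real y) = 0"
      using mass mean by (auto simp: f_def left_diff_distrib sum_subtractf)
    then have "f c + f (Suc c) = 0" "f c * real c + f (Suc c) * real (Suc c) = 0"
      using s[of "\<lambda>_. 1"] s[of real] by auto
    moreover from this have "real c * f c + real c * f (Suc c) = 0" by (simp flip: distrib_left)
    ultimately have "f (Suc c) = 0" by (simp add: algebra_simps)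
    moreover from this have "f c = 0" using \<open>f c + f (Suc c) = 0\<close> by simp
    ultimately have "f x = 0" using True Usub by auto
    then show ?thesis using x by (simp add: f_def)
  qed
qed

text \<open>If \<open>B\<close> were strictly below \<open>C\<close>, then
  \<open>q < p \<le> p' < q'\<close>, so \<open>q'\<close> exceeds \<open>q\<close> by at least two
  and must be the floor \<open>low C\<close>, contradicting \<open>low C \<le> p'\<close>. The other
  orientation is symmetric.\<close>

lemma column_order:
  assumes "compat (p # B) (p' # C)" "compat (q # B) (q' # C)" "q < p" "p' < q'"
    and low: "low B \<le> q" "low C \<le> p'"
  shows "B = C"
  using assms by (auto simp: compat_def intro: adj_antisym)

text \<open>Deleting first letters maps cliques to cliques, so by induction both combinations put
  the same mass \<open>A\<close> on each column. The first moments \<open>m\<close> of the columns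
  have equal totals, and \<open>column_order\<close> forbids them to differ in opposite directions
  in two columns. Inside a column the support has at most two consecutive letters.\<close>

lemma clique_combination_unique:
  fixes a b :: "nat list \<Rightarrow> real"
  assumes "\<And>B. B \<in> words d \<Longrightarrow> 0 \<le> a B" "\<And>B. B \<in> words d \<Longrightarrow> 0 \<le> b B"
    and "\<And>B C. B \<in> words d \<Longrightarrow> C \<in> words d \<Longrightarrow> 0 < a B \<Longrightarrow> 0 < a C \<Longrightarrow> compat B C"
    and "\<And>B C. B \<in> words d \<Longrightarrow> C \<in> words d \<Longrightarrow> 0 < b B \<Longrightarrow> 0 < b C \<Longrightarrow> compat B C"
    and "sum a (words d) = sum b (words d)"
    and "\<And>i. (\<Sum>B\<in>words d. a B * entry B i) = (\<Sum>B\<in>words d. b B * entry B i)"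
    and "B \<in> words d"
  shows "a B = b B"
  using assms
proof (induction d arbitrary: a b B)
  case 0
  then show ?case by (simp add: words_0)
next
  case (Suc d)
  define A where "A a B = (\<Sum>x\<in>column d B. a (x # B))" for a :: "nat list \<Rightarrow> real" and B
  define m where "m a B = (\<Sum>x\<in>column d B. a (x # B) * real x)" for a :: "nat list \<Rightarrow> real" and B
  have mem: "x # B \<in> words (Suc d)" if "B \<in> words d" "x \<in> column d B" for x B
    using that by (simp add: Cons_in_words_iff)
  have nil: "a [] = b []"
    using Nil_coefficient[of d a] Nil_coefficient[of d b] Suc.prems(1-6) by simp
  have Apos: "\<exists>x\<in>column d B. 0 < f (x # B)" if "0 < A f B" for f B
    using that unfolding A_def by (meson not_le sum_nonpos)
  have A_nonneg: "0 \<le> A f B" if "\<And>B. B \<in> words (Suc d) \<Longrightarrow> 0 \<le> f B" "B \<in> words d" for f B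
    unfolding A_def using that mem by (intro sum_nonneg) auto
  have A_clique: "compat B C"
    if f: "\<And>B C. B \<in> words (Suc d) \<Longrightarrow> C \<in> words (Suc d) \<Longrightarrow> 0 < f B \<Longrightarrow> 0 < f C \<Longrightarrow> compat B C"
      and BC: "B \<in> words d" "C \<in> words d" "0 < A f B" "0 < A f C" for f B C
  proof -
    obtain x y where "x \<in> column d B" "y \<in> column d C" "0 < f (x # B)" "0 < f (y # C)"
      using Apos[OF BC(3)] Apos[OF BC(4)] by blast
    then show ?thesis using f[of "x # B" "y # C"] BC mem compat_Cons by blast
  qed
  have A_eq: "A a B = A b B" if "B \<in> words d" for B
  proof (rule Suc.IH[OF A_nonneg A_nonneg])
    show "sum (A a) (words d) = sum (A b) (words d)"
      using Suc.prems(5) nil by (simp add: sum_words_Suc A_def)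
    show "(\<Sum>B\<in>words d. A a B * real (entry B i)) = (\<Sum>B\<in>words d. A b B * real (entry B i))" for i
      using Suc.prems(6)[of "Suc i"] by (simp add: sum_words_Suc A_def sum_distrib_right)
  qed (use Suc.prems(1-4) A_clique that in blast)+
  have m_sum: "sum (m a) (words d) = sum (m b) (words d)"
    using Suc.prems(6)[of 0] by (simp add: sum_words_Suc m_def)
  have above: "\<exists>p\<in>column d B. \<exists>q\<in>column d B. 0 < f (p # B) \<and> 0 < g (q # B) \<and> q < p"
    if f: "\<And>B. B \<in> words (Suc d) \<Longrightarrow> 0 \<le> f B" and g: "\<And>B. B \<in> words (Suc d) \<Longrightarrow> 0 \<le> g B"
      and B: "B \<in> words d" "A f B = A g B" "m g B < m f B" for f g B
  proof (rule ccontr)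
    assume neg: "\<not> ?thesis"
    \<comment> \<open>Pair \<open>p\<close> weighted by \<open>f\<close> with \<open>q\<close>
      weighted by \<open>g\<close>: the weighted total of \<open>p - q\<close> is a positive
      multiple of the gap of the moments, so some pair with \<open>q < p\<close> has positive
      weight.\<close>
    have "(\<Sum>p\<in>column d B. \<Sum>q\<in>column d B. f (p # B) * g (q # B) * (real p - real q))
        = m f B * A g B - A f B * m g B"
      by (simp add: m_def A_def sum_product right_diff_distrib sum_subtractf mult_ac) (rule sum.swap)
    also have "\<dots> = A f B * (m f B - m g B)" using B by (simp add: algebra_simps)
    finally have eq: "(\<Sum>p\<in>column d B. \<Sum>q\<in>column d B. f (p # B) * g (q # B) * (real p - real q))
        = A f B * (m f B - m g B)" .
    have "A f B \<noteq> 0"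
    proof
      assume "A f B = 0"
      then have "f (x # B) = 0" "g (x # B) = 0" if "x \<in> column d B" for x
        using that B f mem g unfolding A_def
        by (auto simp: sum_nonneg_eq_0_iff)
      then show False using B(3) by (simp add: m_def)
    qed
    then have "0 < A f B" using A_nonneg[of f B] f B(1) by fastforce
    moreover have "f (p # B) * g (q # B) * (real p - real q) \<le> 0"
      if "p \<in> column d B" "q \<in> column d B" for p q
    proof (cases "f (p # B) = 0 \<or> g (q # B) = 0")
      case False
      then have "0 < f (p # B)" "0 < g (q # B)"
        using f[of "p # B"] g[of "q # B"] mem[OF B(1)] that by (auto simp: less_le)
      moreover from this have "p \<le> q" using neg that by force
      ultimately show ?thesis by (simp add: mult_le_0_iff)
    qed auto
    then have "(\<Sum>p\<in>column d B. \<Sum>q\<in>column d B. f (p # B) * g (q # B) * (real p - real q)) \<le> 0"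
      by (intro sum_nonpos) auto
    ultimately show False using eq B(3)
      by (metis diff_gt_0_iff_gt mult_pos_pos not_less)
  qed
  have m_le: "m f B \<le> m g B"
    if f: "\<And>B. B \<in> words (Suc d) \<Longrightarrow> 0 \<le> f B" and g: "\<And>B. B \<in> words (Suc d) \<Longrightarrow> 0 \<le> g B"
      and fc: "\<And>B C. B \<in> words (Suc d) \<Longrightarrow> C \<in> words (Suc d) \<Longrightarrow> 0 < f B \<Longrightarrow> 0 < f C \<Longrightarrow> compat B C"
      and gc: "\<And>B C. B \<in> words (Suc d) \<Longrightarrow> C \<in> words (Suc d) \<Longrightarrow> 0 < g B \<Longrightarrow> 0 < g C \<Longrightarrow> compat B C"
      and A: "\<And>B. B \<in> words d \<Longrightarrow> A f B = A g B" and s: "sum (m f) (words d) = sum (m g) (words d)"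
      and B: "B \<in> words d" for f g B
  proof (rule ccontr)
    assume "\<not> m f B \<le> m g B"
    then have lt: "m g B < m f B" by simp
    \<comment> \<open>The moments have the same total, so a surplus in column \<open>B\<close>
      forces a deficit in some column \<open>C\<close>.\<close>
    then obtain C where C: "C \<in> words d" "m f C < m g C"
      using s sum_strict_mono_ex1[of "words d" "m g" "m f"] B by force
    obtain p q where pq: "p \<in> column d B" "q \<in> column d B" "0 < f (p # B)" "0 < g (q # B)" "q < p"
      using above[OF f g B A[OF B] lt] by blast
    obtain q' p' where pq': "q' \<in> column d C" "p' \<in> column d C" "0 < g (q' # C)" "0 < f (p' # C)" "p' < q'"
      using above[OF g f C(1) A[OF C(1), symmetric] C(2)] by blast
    have "B = C"
    proof (rule column_order)
      show "compat (p # B) (p' # C)" using pq pq' B C mem by (intro fc) auto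
      show "compat (q # B) (q' # C)" using pq pq' B C mem by (intro gc) auto
      show "low B \<le> q" "low C \<le> p'" using pq pq' by (auto simp: column_def)
    qed (use pq pq' in auto)
    then show False using lt C(2) by simp
  qed
  have m_eq: "m a B = m b B" if "B \<in> words d" for B
  proof (rule order_antisym)
    show "m a B \<le> m b B"
      by (rule m_le[OF _ _ _ _ A_eq m_sum that]) (use Suc.prems(1-4) in blast)+
    show "m b B \<le> m a B"
      by (rule m_le[OF _ _ _ _ A_eq[symmetric] m_sum[symmetric] that]) (use Suc.prems(1-4) in blast)+
  qed
  show ?case
  proof (cases B)
    case Nil
    then show ?thesis using nil by simp
  next
    case (Cons x B')
    then have B': "B' \<in> words d" "x \<in> column d B'"
      using Suc.prems(7) by (auto simp: Cons_in_words_iff)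
    have near: "y \<le> Suc x" if "compat (x # B') (y # B')" "low B' \<le> x" for x y
      using that by (auto simp: compat_def)
    have "a (x # B') = b (x # B')"
    proof (rule two_point_distribution_unique[of "column d B'" "\<lambda>x. a (x # B')" "\<lambda>x. b (x # B')"])
      show "y \<le> Suc x" if "x \<in> column d B'" "y \<in> column d B'" "0 < a (x # B')" "0 < a (y # B')" for x y
        using that Suc.prems(3) mem[OF B'(1)] by (intro near) (auto simp: column_def)
      show "y \<le> Suc x" if "x \<in> column d B'" "y \<in> column d B'" "0 < b (x # B')" "0 < b (y # B')" for x y
        using that Suc.prems(4) mem[OF B'(1)] by (intro near) (auto simp: column_def)
    qed (use Suc.prems(1,2) mem B' A_eq m_eq in \<open>auto simp: A_def m_def\<close>)
    then show ?thesis using Cons by simp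
  qed
qed

section \<open>Heights for which every non-edge can be swapped downwards\<close>

definition swaps :: "nat \<Rightarrow> (nat list \<Rightarrow> int) \<Rightarrow> nat list \<Rightarrow> nat list \<Rightarrow> bool" where
  "swaps d h v w \<longleftrightarrow> (\<exists>u\<^sub>1\<in>words d. \<exists>u\<^sub>2\<in>words d.
     (\<forall>i. entry u\<^sub>1 i + entry u\<^sub>2 i = entry v i + entry w i) \<and> h u\<^sub>1 + h u\<^sub>2 < h v + h w)"

lemma swaps_commute: "swaps d h v w \<longleftrightarrow> swaps d h w v"
  by (simp add: swaps_def add.commute)

lemma swapsI:
  "u \<in> words d \<Longrightarrow> v \<in> words d \<Longrightarrow> h u + h v < h B + h C \<Longrightarrow>
   (\<And>i. entry u i + entry v i = entry B i + entry C i) \<Longrightarrow> swaps d h B C"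
  by (auto simp: swaps_def)

lemma finite_bound:
  fixes f :: "'a \<Rightarrow> int"
  assumes "finite A"
  obtains R where "0 \<le> R" "\<And>x. x \<in> A \<Longrightarrow> \<bar>f x\<bar> \<le> R"
proof
  show "0 \<le> (\<Sum>x\<in>A. \<bar>f x\<bar>)" by (simp add: sum_nonneg)
  show "\<bar>f x\<bar> \<le> (\<Sum>x\<in>A. \<bar>f x\<bar>)" if "x \<in> A" for x
    using assms that by (intro member_le_sum) auto
qed

text \<open>The squares contribute \<open>- 2 * N * (a - b - 1)\<close> \<le> 0 and the products
  contribute \<open>x - y\<close> < 0; the latter decides the case \<open>a = b + 1\<close>.\<close>

lemma column_swap:
  fixes N a b :: int
  assumes "0 \<le> x" "x \<le> y" "y < N" and "b < a \<and> x < y"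
  shows "(N * (a - 1)\<^sup>2 - (a - 1) * x) + (N * (b + 1)\<^sup>2 - (b + 1) * y)
       < (N * a\<^sup>2 - a * x) + (N * b\<^sup>2 - b * y)"
proof -
  have "0 \<le> N * (a - b - 1)" using assms by (intro mult_nonneg_nonneg) auto
  then show ?thesis using assms by (simp add: power2_eq_square algebra_simps)
qed

text \<open>The squares drop by \<open>2 * N * (b - a - 1)\<close>, which is at least
  \<open>2 * N\<close>, while the products give back only \<open>y - x < N\<close>.\<close>

lemma column_swap':
  fixes N a b :: int
  assumes "0 \<le> x" "x \<le> y" "y < N" and "a + 1 < b"
  shows "(N * (a + 1)\<^sup>2 - (a + 1) * x) + (N * (b - 1)\<^sup>2 - (b - 1) * y)
       < (N * a\<^sup>2 - a * x) + (N * b\<^sup>2 - b * y)"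
proof -
  have "0 \<le> N * (b - a - 2)" using assms by (intro mult_nonneg_nonneg) auto
  then show ?thesis using assms by (simp add: power2_eq_square algebra_simps)
qed

text \<open>The height function is lexicographic: the base height dominates, then the square of the
  first letter, and its product with the sum of the remaining letters breaks ties.\<close>

lemma swapping_height_exists:
  "\<exists>h. \<forall>v\<in>words d. \<forall>w\<in>words d. \<not> compat v w \<longrightarrow> swaps d h v w"
proof (induction d)
  case 0
  then show ?case by (simp add: words_0)
next
  case (Suc d)
  then obtain h where h: "\<And>v w. v \<in> words d \<Longrightarrow> w \<in> words d \<Longrightarrow> \<not> compat v w \<Longrightarrow> swaps d h v w"
    by blast
  define W :: "nat list \<Rightarrow> int" where "W B = int (sum_list B)" for B
  have W0: "0 \<le> W B" for B by (simp add: W_def)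
  obtain M where M: "\<And>B. B \<in> words d \<Longrightarrow> \<bar>W B\<bar> \<le> M"
    using finite_bound[OF finite_words, of d W] by blast
  define N where "N = M + 1"
  have N: "W B < N" if "B \<in> words d" for B using M[OF that] by (simp add: N_def)
  define \<phi> where "\<phi> a B = N * (int a)\<^sup>2 - int a * W B" for a B
  obtain R where R: "0 \<le> R" "\<And>B x. B \<in> words d \<Longrightarrow> x \<in> column d B \<Longrightarrow> \<bar>\<phi> x B\<bar> \<le> R"
  proof (rule finite_bound[of "SIGMA B:words d. column d B" "\<lambda>(B, x). \<phi> x B"])
    fix R assume R: "0 \<le> R"
      "\<And>z. z \<in> (SIGMA B:words d. column d B) \<Longrightarrow> \<bar>case z of (B, x) \<Rightarrow> \<phi> x B\<bar> \<le> R"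
    show thesis using that[OF R(1)] R(2)[of "(_, _)"] by simp
  qed simp
  \<comment> \<open>Since \<open>h\<close> is integer valued, a swap in the base lowers the first
    summand by at least \<open>4 * R + 1\<close>, more than the four values of \<open>\<phi>\<close>
    involved can compensate.\<close>
  define g where "g a B = (4 * R + 1) * h B + \<phi> a B" for a B
  obtain R' where R': "0 \<le> R'" "\<And>B x. B \<in> words d \<Longrightarrow> x \<in> column d B \<Longrightarrow> \<bar>g x B\<bar> \<le> R'"
  proof (rule finite_bound[of "SIGMA B:words d. column d B" "\<lambda>(B, x). g x B"])
    fix R assume R: "0 \<le> R"
      "\<And>z. z \<in> (SIGMA B:words d. column d B) \<Longrightarrow> \<bar>case z of (B, x) \<Rightarrow> g x B\<bar> \<le> R"
    show thesis using that[OF R(1)] R(2)[of "(_, _)"] by simp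
  qed simp
  \<comment> \<open>The apex is placed so high that trading it for \<open>[1]\<close> always pays:
    the two new heights are together at most \<open>2 * R'\<close>, the two old ones at least
    \<open>2 * R' + 1\<close>.\<close>
  define H where "H C = (case C of [] \<Rightarrow> 3 * R' + 1 | x # B \<Rightarrow> g x B)" for C
  have H_simps [simp]: "H [] = 3 * R' + 1" "H (x # B) = g x B" for x B
    by (auto simp: H_def)
  have nil: "swaps (Suc d) H [] (b # C)"
    if "b # C \<in> words (Suc d)" "b \<noteq> low C" for b C
  proof (rule swapsI[of "[1]" _ "(b - 1) # C"])
    have bC: "C \<in> words d" "b \<in> column d C" "low C < b"
      using that by (auto simp: Cons_in_words_iff column_def)
    show mem: "[1] \<in> words (Suc d)" "(b - 1) # C \<in> words (Suc d)"
      using bC by (auto simp: Cons_in_words_iff column_def)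
    show "H [1] + H ((b - 1) # C) < H [] + H (b # C)"
      using R'(2)[of "[]" 1] R'(2)[of C "b - 1"] R'(2)[of C b] mem bC
      by (simp add: Cons_in_words_iff)
    show "entry [1] i + entry ((b - 1) # C) i = entry [] i + entry (b # C) i" for i
      using bC by (cases i) auto
  qed
  have base: "swaps (Suc d) H (a # B) (b # C)"
    if mem: "a # B \<in> words (Suc d)" "b # C \<in> words (Suc d)" and nc: "\<not> compat B C" for a b B C
  proof -
    have B: "B \<in> words d" "a \<in> column d B" and C: "C \<in> words d" "b \<in> column d C"
      using mem by (auto simp: Cons_in_words_iff)
    obtain u v where uv: "u \<in> words d" "v \<in> words d" "\<And>i. entry u i + entry v i = entry B i + entry C i"
      "h u + h v < h B + h C"
      using h[OF B(1) C(1) nc] by (auto simp: swaps_def)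
    \<comment> \<open>The least letter over \<open>u\<close> for which the remaining letter
      \<open>a + b - p\<close> stays within the top \<open>d + 2\<close>. Both letters fit above
      their floors because \<open>low u + low v = low B + low C\<close>.\<close>
    define p where "p = max (low u) (a + b - (d + 2))"
    have low: "low u + low v = low B + low C" "low u \<le> d + 2" "low v \<le> d + 2"
      using uv(3)[of 0] uv(1,2) by (auto simp: low_eq_entry words_def)
    have p: "p \<in> column d u" "a + b - p \<in> column d v" "p \<le> a + b"
      using low B(2) C(2) by (auto simp: p_def column_def)
    show ?thesis
    proof (rule swapsI[of "p # u" _ "(a + b - p) # v"])
      show "p # u \<in> words (Suc d)" "(a + b - p) # v \<in> words (Suc d)"
        using uv p by (auto simp: Cons_in_words_iff)
      have "(4 * R + 1) * (h u + h v) \<le> (4 * R + 1) * (h B + h C - 1)"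
        using uv(4) R(1) by (intro mult_left_mono) auto
      then show "H (p # u) + H ((a + b - p) # v) < H (a # B) + H (b # C)"
        using R(2)[OF uv(1) p(1)] R(2)[OF uv(2) p(2)] R(2)[OF B] R(2)[OF C] R(1)
        by (simp add: g_def algebra_simps)
      show "entry (p # u) i + entry ((a + b - p) # v) i = entry (a # B) i + entry (b # C) i" for i
        using uv(3) p(3) by (cases i) auto
    qed
  qed
  have heights: "swaps (Suc d) H (a # B) (b # C)"
    if mem: "a # B \<in> words (Suc d)" "b # C \<in> words (Suc d)"
      and nc: "\<not> compat (a # B) (b # C)" and adj: "adj B C" and eq: "B = C \<Longrightarrow> a \<le> b" for a b B C
  proof -
    have B: "B \<in> words d" "low B \<le> a" "a \<le> d + 2" and C: "C \<in> words d" "low C \<le> b" "b \<le> d + 2"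
      using mem by (auto simp: Cons_in_words_iff column_def)
    have W: "W B \<le> W C" "B \<noteq> C \<Longrightarrow> W B < W C"
      using adj_sum_list[OF adj] by (auto simp: W_def)
    have low: "low B \<le> low C" using adj_low[OF adj] .
    \<comment> \<open>With an edge from \<open>B\<close> up to \<open>C\<close>, incompatibility can
      only come from the letters: either the letter falls along the edge, or it jumps by more than
      one to a place above the floor.\<close>
    have "b < a \<or> Suc a < b \<and> low C < b"
      using nc adj C(2) by (auto simp: compat_def)
    then show ?thesis
    proof
      assume ab: "b < a"
      then have "W B < W C" using eq W by force
      show ?thesis
      proof (rule swapsI[of "(a - 1) # B" _ "(b + 1) # C"])
        show "(a - 1) # B \<in> words (Suc d)" "(b + 1) # C \<in> words (Suc d)"
          using B C ab low by (auto simp: Cons_in_words_iff column_def)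
        show "H ((a - 1) # B) + H ((b + 1) # C) < H (a # B) + H (b # C)"
          using column_swap[of "W B" "W C" N "int b" "int a"] W0[of B] N[OF C(1)] \<open>W B < W C\<close> ab
          by (simp add: g_def \<phi>_def add.commute)
        show "entry ((a - 1) # B) i + entry ((b + 1) # C) i = entry (a # B) i + entry (b # C) i" for i
          using ab by (cases i) auto
      qed
    next
      assume ab: "Suc a < b \<and> low C < b"
      show ?thesis
      proof (rule swapsI[of "(a + 1) # B" _ "(b - 1) # C"])
        show "(a + 1) # B \<in> words (Suc d)" "(b - 1) # C \<in> words (Suc d)"
          using B C ab low by (auto simp: Cons_in_words_iff column_def)
        show "H ((a + 1) # B) + H ((b - 1) # C) < H (a # B) + H (b # C)"
          using column_swap'[of "W B" "W C" N "int a" "int b"] W0[of B] N[OF C(1)] W ab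
          by (simp add: g_def \<phi>_def add.commute)
        show "entry ((a + 1) # B) i + entry ((b - 1) # C) i = entry (a # B) i + entry (b # C) i" for i
          using ab by (cases i) auto
      qed
    qed
  qed
  have "swaps (Suc d) H v w"
    if mem: "v \<in> words (Suc d)" "w \<in> words (Suc d)" and nc: "\<not> compat v w" for v w
  proof (cases v; cases w)
    fix a B b C assume vw: "v = a # B" "w = b # C"
    consider "\<not> compat B C" | "adj B C" "B = C \<Longrightarrow> a \<le> b" | "adj C B" "C = B \<Longrightarrow> b \<le> a"
      by (auto simp: compat_def intro: linorder_le_cases[of a b])
    then show ?thesis
    proof cases
      case 1
      then show ?thesis using base mem vw by simp
    next
      case 2
      then show ?thesis using heights[of a B b C] mem nc vw by simp
    next
      case 3
      then show ?thesis
        using heights[of b C a B] mem nc vw compat_commute swaps_commute by metis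
    qed
  next
    fix a B assume "v = a # B" "w = []"
    then show ?thesis using nil[of a B] mem nc swaps_commute by auto
  next
    fix a B assume "v = []" "w = a # B"
    then show ?thesis using nil[of a B] mem nc by auto
  qed (use nc in auto)
  then show ?case by blast
qed

section \<open>Maximal cliques and the lattice they generate\<close>

definition max_clique :: "nat \<Rightarrow> nat list set \<Rightarrow> bool" where
  "max_clique d S \<longleftrightarrow> S \<subseteq> words d \<and> (\<forall>B\<in>S. \<forall>C\<in>S. compat B C)
     \<and> (\<forall>B\<in>words d. (\<forall>C\<in>S. compat B C) \<longrightarrow> B \<in> S)"

definition tails :: "nat list set \<Rightarrow> nat list set" where
  "tails S = {B. \<exists>x. x # B \<in> S}"

lemma tails_subset: "S \<subseteq> words (Suc d) \<Longrightarrow> tails S \<subseteq> words d"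
  by (auto simp: tails_def Cons_in_words_iff)

text \<open>Words joined to the apex lie on the floor, and by \<open>adj_low\<close> two floor words
  are compatible whenever their tails are. So the clique is a cone over the floor copy of a maximal
  clique one dimension lower.\<close>

lemma max_clique_structure_Nil:
  assumes S: "max_clique (Suc d) S" and nil: "[] \<in> S"
  shows "S = insert [] ((\<lambda>B. low B # B) ` tails S)" "max_clique d (tails S)"
proof -
  have sub: "S \<subseteq> words (Suc d)" and cl: "\<And>B C. B \<in> S \<Longrightarrow> C \<in> S \<Longrightarrow> compat B C"
    and mx: "\<And>B. B \<in> words (Suc d) \<Longrightarrow> (\<And>C. C \<in> S \<Longrightarrow> compat B C) \<Longrightarrow> B \<in> S"
    using S by (auto simp: max_clique_def)
  have hd: "x = low B" if "x # B \<in> S" for x B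
    using cl[OF nil that] by simp
  show eq: "S = insert [] ((\<lambda>B. low B # B) ` tails S)"
  proof (intro set_eqI)
    fix C show "C \<in> S \<longleftrightarrow> C \<in> insert [] ((\<lambda>B. low B # B) ` tails S)"
      using nil hd by (cases C) (auto simp: tails_def)
  qed
  show "max_clique d (tails S)"
    unfolding max_clique_def
  proof (intro conjI ballI impI)
    show "tails S \<subseteq> words d" using tails_subset[OF sub] .
    show "compat B C" if "B \<in> tails S" "C \<in> tails S" for B C
      using that cl compat_Cons by (fastforce simp: tails_def)
    fix u assume u: "u \<in> words d" "\<forall>C\<in>tails S. compat u C"
    have "low u # u \<in> S"
    proof (rule mx)
      show "low u # u \<in> words (Suc d)" using u by (auto simp: Cons_in_words_iff column_def words_def)
      fix C assume "C \<in> S"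
      then consider "C = []" | B where "B \<in> tails S" "C = low B # B" using eq by blast
      then show "compat (low u # u) C"
        by cases (use u adj_low in \<open>auto simp: compat_def\<close>)
    qed
    then show "u \<in> tails S" by (auto simp: tails_def)
  qed
qed

text \<open>Take the smallest first letter \<open>m\<close> and, if it is below the top, the word
  \<open>m # B\<close> of largest letter sum with it: \<open>Suc m # B\<close> is still compatible
  with every member. If all letters are at the top, the word of smallest letter sum can be lowered
  by one instead.\<close>

lemma max_clique_double:
  assumes S: "max_clique (Suc d) S" and nil: "[] \<notin> S"
  obtains p c where "c # p \<in> S" "Suc c # p \<in> S"
proof -
  have sub: "S \<subseteq> words (Suc d)" and cl: "\<And>B C. B \<in> S \<Longrightarrow> C \<in> S \<Longrightarrow> compat B C"
    and mx: "\<And>B. B \<in> words (Suc d) \<Longrightarrow> (\<And>C. C \<in> S \<Longrightarrow> compat B C) \<Longrightarrow> B \<in> S"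
    using S by (auto simp: max_clique_def)
  have cons: "\<exists>x B. C = x # B \<and> B \<in> words d \<and> low B \<le> x \<and> x \<le> d + 2" if "C \<in> S" for C
    using that subsetD[OF sub that] nil by (cases C) (auto simp: Cons_in_words_iff column_def)
  have fin: "finite S" using finite_subset[OF sub finite_words] .
  have "S \<noteq> {}" using mx[of "[]"] nil by auto
  then obtain v where v: "v \<in> S" "\<And>w. w \<in> S \<Longrightarrow> hd v \<le> hd w"
    using ex_is_arg_min_if_finite[OF fin, of hd] by (auto simp: is_arg_min_linorder)
  define m where "m = hd v"
  have m_le: "m \<le> x" if "x # B \<in> S" for x B using v(2)[OF that] by (simp add: m_def)
  show ?thesis
  proof (cases "m < d + 2")
    case True
    define M where "M = {w \<in> S. hd w = m}"
    have "finite M" "M \<noteq> {}" using fin v(1) by (auto simp: M_def m_def)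
    then have "Max (sum_list ` M) \<in> sum_list ` M" by (intro Max_in) auto
    then obtain w where w0: "w \<in> M" "Max (sum_list ` M) = sum_list w" by auto
    have w: "w \<in> M" "\<And>u. u \<in> M \<Longrightarrow> sum_list u \<le> sum_list w"
      unfolding w0(2)[symmetric] using w0(1) \<open>finite M\<close> by auto
    then obtain B where B: "w = m # B" "B \<in> words d" "low B \<le> m" "m # B \<in> S"
      using cons[of w] by (auto simp: M_def)
    have "Suc m # B \<in> S"
    proof (rule mx)
      show "Suc m # B \<in> words (Suc d)" using B True by (auto simp: Cons_in_words_iff column_def)
      fix C assume C: "C \<in> S"
      then obtain x D where D: "C = x # D" using cons by blast
      have comp: "compat (m # B) (x # D)" using cl B C D by simp
      have mx: "m \<le> x" using m_le C D by simp
      show "compat (Suc m # B) C"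
      proof (cases "x = m")
        case True
        then have "sum_list D \<le> sum_list B"
          using w(2)[of C] C D B(1) by (simp add: M_def)
        then have "adj D B"
          using comp adj_sum_list[of B D] by (auto simp: compat_def)
        then show ?thesis using True D by (simp add: compat_def)
      next
        case False
        then show ?thesis using comp mx D by (auto simp: compat_def)
      qed
    qed
    then show ?thesis using that B(4) by blast
  next
    case False
    then have top: "\<exists>B. C = (d + 2) # B \<and> B \<in> words d \<and> low B \<le> d + 2" if "C \<in> S" for C
      using cons[OF that] that m_le by fastforce
    obtain w where w: "w \<in> S" "\<And>u. u \<in> S \<Longrightarrow> sum_list w \<le> sum_list u"
      using ex_is_arg_min_if_finite[OF fin \<open>S \<noteq> {}\<close>, of sum_list] by (auto simp: is_arg_min_linorder)
    obtain B where B: "w = (d + 2) # B" "B \<in> words d" using top[OF w(1)] by blast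
    have least: "adj B D" if "(d + 2) # D \<in> S" for D
      using cl[OF w(1) that] w(2)[OF that] adj_sum_list[of D B] B(1) by (auto simp: compat_def)
    show ?thesis
    proof (cases "low B \<le> d + 1")
      case True
      have "(d + 1) # B \<in> S"
      proof (rule mx)
        show "(d + 1) # B \<in> words (Suc d)" using B True by (auto simp: Cons_in_words_iff column_def)
        fix C assume C: "C \<in> S"
        then show "compat ((d + 1) # B) C" using top[OF C] least by (auto simp: compat_def)
      qed
      then show ?thesis using that[of "d + 1" B] w(1) B(1) by simp
    next
      case False
      \<comment> \<open>Here the lowest column has its floor at the top \<open>d + 2\<close>. Floors
        rise along edges, so every member is a floor word and is joined to the apex; maximality then
        puts \<open>[]\<close> into \<open>S\<close>.\<close>
      have "[] \<in> S"
      proof (rule mx)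
        fix C assume C: "C \<in> S"
        then show "compat [] C" using top[OF C] least adj_low False by fastforce
      qed simp
      then show ?thesis using nil by simp
    qed
  qed
qed

text \<open>The stage of a chimney: every column above the pivot \<open>p\<close> has already been raised
  to level \<open>Suc c\<close>, the other ones still are at level \<open>c\<close>.\<close>

definition stage :: "nat list \<Rightarrow> nat \<Rightarrow> nat list \<Rightarrow> nat" where
  "stage p c B = (if B \<noteq> p \<and> adj p B then max (Suc c) (low B) else c)"

lemma stage_pivot [simp]: "stage p c p = c"
  by (simp add: stage_def)

text \<open>Going up from a word strictly above the pivot, one stays strictly above it, since letter
  sums exclude a way back; hence the stage letter never falls. It exceeds its predecessor by more
  than one only when it is the floor letter of the upper word.\<close>

lemma adj_stage:
  assumes "adj B C" "compat B p" "compat C p"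
  shows "adj (stage p c B # B) (stage p c C # C)"
proof -
  have "adj p C" "C \<noteq> p" if "adj p B" "B \<noteq> p"
  proof -
    show "C \<noteq> p" using that assms(1) adj_antisym by blast
    show "adj p C"
    proof (rule ccontr)
      assume "\<not> adj p C"
      then have "adj C p" using assms(3) by (auto simp: compat_def)
      then have "sum_list p = sum_list B"
        using adj_sum_list[OF that(1)] adj_sum_list[OF assms(1)] adj_sum_list[of C p] by simp
      then show False using adj_sum_list[OF that(1)] that(2) by simp
    qed
  qed
  then show ?thesis
    using assms(1) adj_low[OF assms(1)] by (auto simp: stage_def)
qed

lemma compat_stage:
  assumes "compat B C" "compat B p" "compat C p"
  shows "compat (stage p c B # B) (stage p c C # C)"
  using assms adj_stage unfolding compat_def by blast

lemma compat_stage_Suc: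
  assumes "compat B p" shows "compat (stage p c B # B) (Suc c # p)"
  using assms by (auto simp: stage_def compat_def)

text \<open>The two letters over the pivot \<open>p\<close> determine the letter over every other
  tail. So taking tails merges exactly one pair of words, and any word compatible with all tails can
  be lifted by \<open>stage\<close>, whence the tails are maximal too.\<close>

lemma max_clique_structure_Cons:
  assumes S: "max_clique (Suc d) S" and nil: "[] \<notin> S" and p: "c # p \<in> S" "Suc c # p \<in> S"
  shows "S = insert (Suc c # p) ((\<lambda>B. stage p c B # B) ` tails S)" "max_clique d (tails S)"
proof -
  have sub: "S \<subseteq> words (Suc d)" and cl: "\<And>B C. B \<in> S \<Longrightarrow> C \<in> S \<Longrightarrow> compat B C"
    and mx: "\<And>B. B \<in> words (Suc d) \<Longrightarrow> (\<And>C. C \<in> S \<Longrightarrow> compat B C) \<Longrightarrow> B \<in> S"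
    using S by (auto simp: max_clique_def)
  have lowp: "low p \<le> c" "Suc c \<le> d + 2"
    using subsetD[OF sub p(1)] subsetD[OF sub p(2)] by (auto simp: Cons_in_words_iff column_def)
  have pt: "p \<in> tails S" using p by (auto simp: tails_def)
  \<comment> \<open>Compatibility with both \<open>c # p\<close> and \<open>Suc c # p\<close> forces
    the letter: below the pivot it is \<open>c\<close>, strictly above the pivot it is the least
    letter that is at least \<open>Suc c\<close> and not under the floor.\<close>
  have hd: "x = stage p c B \<or> B = p \<and> x = Suc c" if "x # B \<in> S" for x B
  proof -
    have low: "low B \<le> x" using subsetD[OF sub that] by (auto simp: Cons_in_words_iff column_def)
    have "compat (x # B) (c # p)" "compat (x # B) (Suc c # p)"
      using cl that p by auto
    then show ?thesis using low lowp adj_low[of B p] adj_antisym[of B p]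
      by (auto simp: compat_def stage_def)
  qed
  have tcl: "compat B C" if "B \<in> tails S" "C \<in> tails S" for B C
    using that cl compat_Cons by (fastforce simp: tails_def)
  show eq: "S = insert (Suc c # p) ((\<lambda>B. stage p c B # B) ` tails S)"
  proof (intro set_eqI)
    fix C show "C \<in> S \<longleftrightarrow> C \<in> insert (Suc c # p) ((\<lambda>B. stage p c B # B) ` tails S)"
    proof
      show "C \<in> insert (Suc c # p) ((\<lambda>B. stage p c B # B) ` tails S)" if "C \<in> S"
        using that nil hd by (cases C) (auto simp: tails_def)
      show "C \<in> S" if "C \<in> insert (Suc c # p) ((\<lambda>B. stage p c B # B) ` tails S)"
        using that p hd by (auto simp: tails_def) (metis stage_pivot)
    qed
  qed
  show "max_clique d (tails S)"
    unfolding max_clique_def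
  proof (intro conjI ballI impI)
    show "tails S \<subseteq> words d" using tails_subset[OF sub] .
    show "compat B C" if "B \<in> tails S" "C \<in> tails S" for B C using tcl that .
    fix u assume u: "u \<in> words d" "\<forall>C\<in>tails S. compat u C"
    have "stage p c u # u \<in> S"
    proof (rule mx)
      have "low u \<le> stage p c u"
        using u(2) pt lowp adj_low[of u p] by (auto simp: stage_def compat_def)
      then show "stage p c u # u \<in> words (Suc d)"
        using u(1) lowp by (auto simp: Cons_in_words_iff column_def words_def stage_def)
      fix C assume "C \<in> S"
      then consider "C = Suc c # p" | B where "B \<in> tails S" "C = stage p c B # B" using eq by blast
      then show "compat (stage p c u # u) C"
        by cases (use u pt tcl compat_stage compat_stage_Suc in auto)
    qed
    then show "u \<in> tails S" by (auto simp: tails_def)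
  qed
qed

text \<open>The total \<open>t\<close> is free because the cone case of the induction prescribes the
  total on the tails in terms of \<open>z\<close>. In both cases the clique has one word more than
  its tails, and its weight serves to meet the one remaining condition.\<close>

lemma max_clique_generates:
  fixes z :: "nat \<Rightarrow> int"
  assumes "max_clique d S"
  shows "\<exists>b. sum b S = t \<and> (\<forall>i<d. (\<Sum>B\<in>S. b B * int (entry B i)) = z i)"
  using assms
proof (induction d arbitrary: S z t)
  case 0
  then have "S = {[]}" by (auto simp: max_clique_def words_0)
  then show ?case by (intro exI[of _ "\<lambda>_. t"]) simp
next
  case (Suc d)
  have sub: "S \<subseteq> words (Suc d)" using Suc.prems by (auto simp: max_clique_def)
  have fin: "finite (tails S)" using finite_subset[OF tails_subset[OF sub] finite_words] .
  show ?case
  proof (cases "[] \<in> S")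
    case True
    note eq = max_clique_structure_Nil[OF Suc.prems True]
    \<comment> \<open>\<open>y\<close> is the combination of the first letters of the tails. A floor
      letter is one more than the first letter of its tail, so total weight \<open>z 0 - y\<close>
      on the tails yields \<open>z 0\<close>; the apex has no letters and absorbs the rest of
      \<open>t\<close>. For \<open>d = 0\<close> the only possible tail is \<open>[]\<close>, hence
      the default 0.\<close>
    define y where "y = (if d = 0 then 0 else z 1)"
    obtain b where b: "sum b (tails S) = z 0 - y"
      "\<And>i. i < d \<Longrightarrow> (\<Sum>B\<in>tails S. b B * int (entry B i)) = z (Suc i)"
      using Suc.IH[OF eq(2), of "z 0 - y" "\<lambda>i. z (Suc i)"] by blast
    have y: "(\<Sum>B\<in>tails S. b B * int (entry B 0)) = y"
    proof (cases d)
      case 0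
      then have "tails S \<subseteq> {[]}" using tails_subset[OF sub] by (simp add: words_0)
      then show ?thesis using 0 by (auto simp: y_def intro!: sum.neutral)
    next
      case (Suc k)
      then show ?thesis using b(2)[of 0] by (simp add: y_def)
    qed
    define b' where "b' C = (if C = [] then t - (z 0 - y) else b (tl C))" for C
    have s: "(\<Sum>C\<in>S. b' C * f C) = (t - (z 0 - y)) * f [] + (\<Sum>B\<in>tails S. b B * f (low B # B))" for f
      by (subst eq(1), subst sum.insert)
        (use fin in \<open>auto simp: sum.reindex inj_on_def b'_def\<close>)
    have "sum b' S = t" using s[of "\<lambda>_. 1"] b(1) by simp
    moreover have "(\<Sum>B\<in>S. b' B * int (entry B i)) = z i" if "i < Suc d" for i
    proof (cases i)
      case 0
      then show ?thesis
        using s[of "\<lambda>B. int (entry B i)"] y b(1)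
        by (simp add: low_eq_entry distrib_left sum.distrib)
    next
      case (Suc k)
      then show ?thesis using s[of "\<lambda>B. int (entry B i)"] b(2)[of k] that by simp
    qed
    ultimately show ?thesis by blast
  next
    case False
    obtain p c where p: "c # p \<in> S" "Suc c # p \<in> S"
      using max_clique_double[OF Suc.prems False] by blast
    note eq = max_clique_structure_Cons[OF Suc.prems False p]
    obtain b where b: "sum b (tails S) = t"
      "\<And>i. i < d \<Longrightarrow> (\<Sum>B\<in>tails S. b B * int (entry B i)) = z (Suc i)"
      using Suc.IH[OF eq(2), of t "\<lambda>i. z (Suc i)"] by blast
    \<comment> \<open>Moving weight \<open>e\<close> from \<open>c # p\<close> to
      \<open>Suc c # p\<close> changes the first coordinate by \<open>e\<close> and neither the
      total nor any other coordinate.\<close>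
    define e where "e = z 0 - (\<Sum>B\<in>tails S. b B * int (stage p c B))"
    define b' where "b' C = (if C = Suc c # p then e else b (tl C) - (if tl C = p then e else 0))" for C
    have pt: "p \<in> tails S" using p by (auto simp: tails_def)
    have notin: "Suc c # p \<notin> (\<lambda>B. stage p c B # B) ` tails S" by auto
    have s: "(\<Sum>C\<in>S. b' C * f C) = e * f (Suc c # p) - e * f (c # p)
        + (\<Sum>B\<in>tails S. b B * f (stage p c B # B))" for f
    proof -
      have "(\<Sum>C\<in>S. b' C * f C) = e * f (Suc c # p)
          + (\<Sum>B\<in>tails S. (b B - (if B = p then e else 0)) * f (stage p c B # B))"
        by (subst eq(1), subst sum.insert)
          (use fin notin in \<open>auto simp: sum.reindex inj_on_def b'_def intro!: sum.cong\<close>)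
      also have "(\<Sum>B\<in>tails S. (b B - (if B = p then e else 0)) * f (stage p c B # B))
          = (\<Sum>B\<in>tails S. b B * f (stage p c B # B)) - (\<Sum>B\<in>tails S. if B = p then e * f (c # p) else 0)"
        by (subst sum_subtractf[symmetric], intro sum.cong) (auto simp: left_diff_distrib)
      also have "(\<Sum>B\<in>tails S. if B = p then e * f (c # p) else 0) = e * f (c # p)"
        using fin pt by simp
      finally show ?thesis by simp
    qed
    have "sum b' S = t" using s[of "\<lambda>_. 1"] b(1) by simp
    moreover have "(\<Sum>B\<in>S. b' B * int (entry B i)) = z i" if "i < Suc d" for i
    proof (cases i)
      case 0
      then show ?thesis using s[of "\<lambda>B. int (entry B i)"] by (simp add: e_def algebra_simps)
    next
      case (Suc k)
      then show ?thesis using s[of "\<lambda>B. int (entry B i)"] b(2)[of k] that by simp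
    qed
    ultimately show ?thesis by blast
  qed
qed


section \<open>Lecture hall sequences\<close>

text \<open>Lecture hall sequences from the largest coordinate downwards. The division is the
  integer form of \<open>y_d / (d + 1) \<le> y_(d+1) / (d + 2)\<close>, and \<open>K\<close> bounds
  the largest coordinate only.\<close>

primrec hall :: "nat \<Rightarrow> nat \<Rightarrow> nat list set" where
  "hall 0 K = {[]}"
| "hall (Suc d) K = (\<lambda>(a, B). a # B) ` (SIGMA a:{..K}. hall d (a * Suc d div (d + 2)))"

lemma finite_hall [simp]: "finite (hall d K)"
  by (induction d arbitrary: K) auto

lemma card_hall_Suc: "card (hall (Suc d) K) = (\<Sum>a\<le>K. card (hall d (a * Suc d div (d + 2))))"
  by (simp add: card_image inj_on_def case_prod_unfold)

lemma in_hall_iff: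
  "B \<in> hall d K \<longleftrightarrow> length B = d \<and> entry B 0 \<le> K \<and>
     (\<forall>i. Suc i < d \<longrightarrow> entry B (Suc i) * (d - i + 1) \<le> entry B i * (d - i))"
proof (induction d arbitrary: B K)
  case 0
  then show ?case by auto
next
  case (Suc d)
  show ?case
  proof (cases B)
    case Nil
    then show ?thesis by auto
  next
    case (Cons a C)
    have "B \<in> hall (Suc d) K \<longleftrightarrow> a \<le> K \<and> C \<in> hall d (a * Suc d div (d + 2))"
      using Cons by auto
    also have "\<dots> \<longleftrightarrow> a \<le> K \<and> length C = d \<and> entry C 0 * (d + 2) \<le> a * Suc d \<and>
       (\<forall>i. Suc i < d \<longrightarrow> entry C (Suc i) * (d - i + 1) \<le> entry C i * (d - i))"
      unfolding Suc.IH by (simp add: less_eq_div_iff_mult_less_eq)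
    also have "\<dots> \<longleftrightarrow> a \<le> K \<and> length C = d \<and>
       (\<forall>i. Suc i < Suc d \<longrightarrow> entry B (Suc i) * (Suc d - i + 1) \<le> entry B i * (Suc d - i))"
    proof -
      have "entry C 0 * (d + 2) \<le> a * Suc d" if "length C = d" "d = 0"
        using that by simp
      moreover have "(\<forall>i. Suc i < Suc d \<longrightarrow> P i) \<longleftrightarrow> (0 < d \<longrightarrow> P 0) \<and> (\<forall>i. Suc i < d \<longrightarrow> P (Suc i))" for P
      proof (intro iffI allI impI)
        fix i assume "(0 < d \<longrightarrow> P 0) \<and> (\<forall>i. Suc i < d \<longrightarrow> P (Suc i))" "Suc i < Suc d"
        then show "P i" by (cases i) auto
      qed auto
      ultimately show ?thesis
        unfolding Cons by auto
    qed
    finally show ?thesis using Cons by auto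
  qed
qed

declare hall.simps(2) [simp del]

text \<open>Lowering the bound \<open>n * q - r\<close>, where \<open>n = Suc d\<close>, by one
  means raising \<open>r\<close> by one. The right-hand side changes then by its own value for
  \<open>d - 1\<close> with the same \<open>q\<close> and \<open>r\<close>, which counts the
  sequences with the largest coordinate removed.\<close>

lemma card_hall:
  assumes "r \<le> Suc d" "r \<le> Suc d * q"
  shows "int (card (hall d (Suc d * q - r)))
    = (int q + 1) ^ (Suc d - r) * int q ^ r - int q ^ (Suc d - r) * (int q - 1) ^ r"
  using assms
proof (induction d arbitrary: q r)
  case 0
  then consider "r = 0" | "r = 1" by linarith
  then show ?case by cases auto
next
  case (Suc d)
  define G where "G q r = (int q + 1) ^ (d + 2 - r) * int q ^ r - int q ^ (d + 2 - r) * (int q - 1) ^ r"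
    for q r :: nat
  \<comment> \<open>Multiplying \<open>(d + 2) * q - r\<close> by \<open>(d + 1) / (d + 2)\<close>
    gives \<open>(d + 1) * q - r\<close> plus the fraction \<open>r / (d + 2) < 1\<close>.\<close>
  have floor: "(Suc (Suc d) * q - r) * Suc d div (d + 2) = Suc d * q - r"
    if r: "r \<le> Suc d" "r \<le> Suc d * q" for q r
  proof -
    obtain a where a: "Suc d * q = r + a" using r(2) le_Suc_ex by blast
    then have "(Suc (Suc d) * q - r) * Suc d = a * (d + 2) + r"
      by (simp add: algebra_simps)
    moreover have "(a * (d + 2) + r) div (d + 2) = a" using r(1) by (simp only: div_mult_self3) simp
    ultimately have "(Suc (Suc d) * q - r) * Suc d div (d + 2) = a" by (simp only:)
    moreover have "Suc d * q - r = a" unfolding a by simp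
    ultimately show ?thesis by (simp only:)
  qed
  have step: "int (card (hall d (Suc d * q - r))) = G q r - G q (Suc r)"
    if "r \<le> Suc d" "r \<le> Suc d * q" for q r
  proof -
    have e: "d + 2 - r = Suc (Suc d - r)" "d + 2 - Suc r = Suc d - r" using that by auto
    show ?thesis
      unfolding G_def e using Suc.IH[OF that] by (simp add: algebra_simps)
  qed
  \<comment> \<open>The two sides belong to two representations of the same bound, with remainder
    \<open>d + 2\<close> and with remainder 0. This lets the induction on \<open>K\<close> pass to
    the next smaller \<open>q\<close>.\<close>
  have wrap: "G q (d + 2) = G (q - 1) 0" if "1 \<le> q" for q
    using that by (simp add: G_def of_nat_diff)
  have "int (card (hall (Suc d) K)) = G q r"
    if "K = Suc (Suc d) * q - r" "r \<le> Suc d" "r \<le> Suc (Suc d) * q" for K q r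
    using that
  proof (induction K arbitrary: q r)
    case 0
    have "q = 0"
    proof (rule ccontr)
      assume "q \<noteq> 0"
      then have "Suc (Suc d) * 1 \<le> Suc (Suc d) * q" by (intro mult_le_mono2) simp
      then show False using 0 by simp
    qed
    moreover from this have "r = 0" using 0 by simp
    ultimately show ?case using Suc.IH[of 0 0] by (simp add: card_hall_Suc G_def)
  next
    case (Suc K)
    have q: "1 \<le> q" using Suc.prems by (cases q) auto
    have r: "r \<le> Suc d * q" using mult_le_mono2[OF q, of "Suc d"] Suc.prems(2) by simp
    have "int (card (hall (Suc d) K)) = G q (Suc r)"
    proof (cases "r = Suc d")
      case True
      then show ?thesis
        using Suc.IH[of "q - 1" 0] Suc.prems(1) q wrap[of q] by (cases q) auto
    next
      case False
      then show ?thesis using Suc.prems by (intro Suc.IH) auto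
    qed
    moreover have "card (hall (Suc d) (Suc K)) = card (hall (Suc d) K) + card (hall d (Suc d * q - r))"
    proof -
      have e: "Suc K * Suc d div (d + 2) = Suc d * q - r"
        unfolding Suc.prems(1) by (rule floor[OF Suc.prems(2) r])
      show ?thesis unfolding card_hall_Suc sum.atMost_Suc e ..
    qed
    ultimately show ?case using step[OF Suc.prems(2) r] by simp
  qed note main = this
  show ?case
  proof (cases "r = d + 2")
    case True
    then have q: "1 \<le> q" using Suc.prems by (cases q) auto
    have "int (card (hall (Suc d) (Suc (Suc d) * q - r))) = G (q - 1) 0"
      using q True by (intro main) (auto simp: diff_mult_distrib2)
    also have "\<dots> = G q r" using wrap[OF q] True by simp
    finally show ?thesis by (simp add: G_def)
  next
    case False
    then show ?thesis using main[of _ q r] Suc.prems by (simp add: G_def)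
  qed
qed

corollary card_hall_dilate:
  "int (card (hall d (t * Suc d))) = (int t + 1) ^ Suc d - int t ^ Suc d"
  using card_hall[of 0 d t] by (simp add: mult.commute)


section \<open>Eulerian polynomials and sorting\<close>

text \<open>Weakly increasing sequences with strict steps at the positions in \<open>D\<close>, that
  is, the bounded P-partitions of a labelled chain.\<close>

definition chains :: "(nat \<Rightarrow> bool) \<Rightarrow> nat \<Rightarrow> nat \<Rightarrow> (nat \<Rightarrow> nat) set" where
  "chains D n t = {g \<in> extensional {1..n}.
     (\<forall>i\<in>{1..<n}. g i \<le> g (Suc i) \<and> (D i \<longrightarrow> g i < g (Suc i))) \<and> (0 < n \<longrightarrow> g n \<le> t)}"

lemma chains_0: "chains D 0 t = {\<lambda>_. undefined}"
  by (auto simp: chains_def extensional_def)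

text \<open>Splitting off the last value \<open>s\<close> leaves a chain bounded by
  \<open>s\<close>, or by \<open>s - 1\<close> after a strict step. Position 0 carries no
  comparison, hence the condition on \<open>D 0\<close>.\<close>

lemma chains_Suc:
  assumes "\<not> D 0"
  shows "bij_betw (\<lambda>(s, g). g(Suc n := s))
    (SIGMA s:{s. s \<le> t \<and> (D n \<longrightarrow> 0 < s)}. chains D n (if D n then s - 1 else s)) (chains D (Suc n) t)"
    (is "bij_betw _ ?A _")
proof (rule bij_betw_byWitness[where f' = "\<lambda>g. (g (Suc n), restrict g {1..n})"])
  show "\<forall>z\<in>?A. (\<lambda>g. (g (Suc n), restrict g {1..n})) ((\<lambda>(s, g). g(Suc n := s)) z) = z"
    by (auto simp: chains_def extensional_def fun_eq_iff restrict_def)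
  show "\<forall>g\<in>chains D (Suc n) t. (\<lambda>(s, g). g(Suc n := s)) (g (Suc n), restrict g {1..n}) = g"
    by (auto simp: chains_def extensional_def fun_eq_iff restrict_def)
  show "(\<lambda>(s, g). g(Suc n := s)) ` ?A \<subseteq> chains D (Suc n) t"
  proof (rule image_subsetI)
    fix z assume "z \<in> ?A"
    then obtain s g where z: "z = (s, g)" and s: "s \<le> t" "D n \<longrightarrow> 0 < s"
      and g: "g \<in> chains D n (if D n then s - 1 else s)" by auto
    have "(g(Suc n := s)) i \<le> (g(Suc n := s)) (Suc i) \<and>
        (D i \<longrightarrow> (g(Suc n := s)) i < (g(Suc n := s)) (Suc i))" if "i \<in> {1..<Suc n}" for i
      using that g s by (cases "i = n") (auto simp: chains_def split: if_splits)
    then show "(\<lambda>(s, g). g(Suc n := s)) z \<in> chains D (Suc n) t"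
      using g s z by (auto simp: chains_def extensional_def)
  qed
  show "(\<lambda>g. (g (Suc n), restrict g {1..n})) ` chains D (Suc n) t \<subseteq> ?A"
  proof (rule image_subsetI)
    fix g assume g: "g \<in> chains D (Suc n) t"
    then have last: "g n \<le> g (Suc n) \<and> (D n \<longrightarrow> g n < g (Suc n))" if "0 < n"
      using that by (auto simp: chains_def)
    have "n \<noteq> 0" if "D n" using that assms by (cases n) auto
    then show "(g (Suc n), restrict g {1..n}) \<in> ?A"
      using g last by (auto simp: chains_def restrict_def extensional_def)
  qed
qed

lemma finite_chains: "\<not> D 0 \<Longrightarrow> finite (chains D n t)"
proof (induction n arbitrary: t)
  case (Suc n)
  have "finite (SIGMA s:{s. s \<le> t \<and> (D n \<longrightarrow> 0 < s)}. chains D n (if D n then s - 1 else s))"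
    using Suc by (intro finite_SigmaI) auto
  then show ?case using bij_betw_finite[OF chains_Suc[of D n t, OF Suc.prems]] by blast
qed (simp add: chains_0)

lemma card_chains_Suc:
  assumes "\<not> D 0"
  shows "card (chains D (Suc n) t)
    = (\<Sum>s\<in>{s. s \<le> t \<and> (D n \<longrightarrow> 0 < s)}. card (chains D n (if D n then s - 1 else s)))"
proof -
  have "finite {s. s \<le> t \<and> (D n \<longrightarrow> 0 < s)}" by (rule finite_subset[of _ "{..t}"]) auto
  then show ?thesis
    using bij_betw_same_card[OF chains_Suc[of D n t, OF assms], symmetric] finite_chains[of D, OF assms]
    by (subst (asm) card_SigmaI) auto
qed

definition chain_fps :: "(nat \<Rightarrow> bool) \<Rightarrow> nat \<Rightarrow> real fps" where
  "chain_fps D n = Abs_fps (\<lambda>t. real (card (chains D n t)))"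

text \<open>Raising the bound to \<open>t\<close> adds only the chains with last value
  \<open>t\<close>. After a strict step their other values are bounded by \<open>t - 1\<close>,
  which accounts for the factor \<open>fps_X\<close>.\<close>

lemma chain_fps_Suc:
  assumes "\<not> D 0"
  shows "(1 - fps_X) * chain_fps D (Suc n) = (if D n then fps_X else 1) * chain_fps D n"
proof (rule fps_ext)
  fix t
  have set: "{s. s \<le> Suc u \<and> (D n \<longrightarrow> 0 < s)} = insert (Suc u) {s. s \<le> u \<and> (D n \<longrightarrow> 0 < s)}" for u :: nat
    by auto
  have "finite {s. s \<le> u \<and> (D n \<longrightarrow> 0 < s)}" for u :: nat
    by (rule finite_subset[of _ "{..u}"]) auto
  then have "card (chains D (Suc n) (Suc u)) = card (chains D (Suc n) u)
      + card (chains D n (if D n then u else Suc u))" for u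
    unfolding card_chains_Suc[of D, OF assms] set by (subst sum.insert) auto
  moreover have "card (chains D (Suc n) 0) = (if D n then 0 else card (chains D n 0))"
  proof -
    have "{s::nat. s \<le> 0 \<and> (D n \<longrightarrow> 0 < s)} = (if D n then {} else {0})" by auto
    then show ?thesis unfolding card_chains_Suc[of D, OF assms] by simp
  qed
  ultimately show "fps_nth ((1 - fps_X) * chain_fps D (Suc n)) t = fps_nth ((if D n then fps_X else 1) * chain_fps D n) t"
    by (cases t) (auto simp: chain_fps_def left_diff_distrib)
qed

lemma chain_fps_eq:
  assumes "\<not> D 0"
  shows "(1 - fps_X) ^ Suc n * chain_fps D n = fps_X ^ card {i \<in> {1..<n}. D i}"
proof (induction n)
  case 0
  show ?case
  proof (rule fps_ext)
    show "fps_nth ((1 - fps_X) ^ Suc 0 * chain_fps D 0) t = fps_nth (fps_X ^ card {i \<in> {1..<0}. D i}) t" for t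
      by (cases t) (auto simp: chain_fps_def chains_0 left_diff_distrib)
  qed
next
  case (Suc n)
  have "(1 - fps_X) ^ Suc (Suc n) * chain_fps D (Suc n)
      = (1 - fps_X) ^ Suc n * ((1 - fps_X) * chain_fps D (Suc n))"
    by (simp add: mult_ac)
  also have "\<dots> = (if D n then fps_X else 1) * ((1 - fps_X) ^ Suc n * chain_fps D n)"
    unfolding chain_fps_Suc[of D, OF assms] by (simp add: mult_ac)
  also have "\<dots> = (if D n then fps_X else 1) * fps_X ^ card {i \<in> {1..<n}. D i}"
    unfolding Suc.IH ..
  also have "\<dots> = fps_X ^ card {i \<in> {1..<Suc n}. D i}"
  proof -
    have "{i \<in> {1..<Suc n}. D i} = (if D n then insert n {i \<in> {1..<n}. D i} else {i \<in> {1..<n}. D i})"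
      using assms by (auto simp: less_Suc_eq intro: Suc_leI gr0I)
    then show ?thesis by (auto simp: card_insert_if)
  qed
  finally show ?case .
qed

text \<open>Encodes the lexicographic order of the pairs \<open>(f j, j)\<close>, so that sorting is stable.\<close>

definition sort_key :: "nat \<Rightarrow> (nat \<Rightarrow> nat) \<Rightarrow> nat \<Rightarrow> nat" where
  "sort_key n f j = f j * Suc n + j"

lemma sort_key_less_iff:
  assumes "a \<le> n" "b \<le> n"
  shows "sort_key n f a < sort_key n f b \<longleftrightarrow> f a < f b \<or> (f a = f b \<and> a < b)"
proof -
  have "sort_key n f a < sort_key n f b" if "f a < f b" "a \<le> n" for a b
  proof -
    have "Suc (f a) * Suc n \<le> f b * Suc n" using that by (intro mult_le_mono1) simp
    then show ?thesis using that unfolding sort_key_def by simp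
  qed
  from this[of a b] this[of b a] show ?thesis
    using assms by (cases "f a" "f b" rule: linorder_cases) (auto simp: sort_key_def)
qed

definition sorts :: "nat \<Rightarrow> (nat \<Rightarrow> nat) \<Rightarrow> (nat \<Rightarrow> nat) \<Rightarrow> bool" where
  "sorts n \<pi> f \<longleftrightarrow> (\<forall>i\<in>{1..<n}. sort_key n f (\<pi> i) < sort_key n f (\<pi> (Suc i)))"

lemma sort_key_inj: "inj_on (sort_key n f) {1..n}"
proof (rule inj_onI)
  fix a b assume "a \<in> {1..n}" "b \<in> {1..n}" "sort_key n f a = sort_key n f b"
  then show "a = b"
    using sort_key_less_iff[of a n b f] sort_key_less_iff[of b n a f]
    by (cases "f a" "f b" rule: linorder_cases) auto
qed

lemma sorts_mono:
  assumes "sorts n \<pi> f" "i \<in> {1..n}" "j \<in> {1..n}" "i < j"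
  shows "sort_key n f (\<pi> i) < sort_key n f (\<pi> j)"
proof -
  have "Suc i \<le> j" using assms by simp
  then show ?thesis using assms(3)
  proof (induction j rule: dec_induct)
    case base
    then show ?case using assms by (auto simp: sorts_def)
  next
    case (step k)
    then have "sort_key n f (\<pi> k) < sort_key n f (\<pi> (Suc k))"
      using assms by (auto simp: sorts_def)
    then show ?case using step by simp
  qed
qed

text \<open>The keys are distinct, so the place of \<open>j\<close> in the sorted order is the
  number of keys not exceeding its own. The sorting permutation is the inverse of this rank
  function, extended by the identity.\<close>

lemma ex1_sorts:
  "\<exists>!\<pi>. \<pi> permutes {1..n} \<and> sorts n \<pi> f"
proof -
  define rank where "rank j = (if j \<in> {1..n} then card {k \<in> {1..n}. sort_key n f k \<le> sort_key n f j} else j)" for j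
  have rank_less: "rank a < rank b"
    if "a \<in> {1..n}" "b \<in> {1..n}" "sort_key n f a < sort_key n f b" for a b
  proof -
    have "b \<in> {k \<in> {1..n}. sort_key n f k \<le> sort_key n f b}"
      "b \<notin> {k \<in> {1..n}. sort_key n f k \<le> sort_key n f a}"
      "{k \<in> {1..n}. sort_key n f k \<le> sort_key n f a} \<subseteq> {k \<in> {1..n}. sort_key n f k \<le> sort_key n f b}"
      using that by auto
    then have "{k \<in> {1..n}. sort_key n f k \<le> sort_key n f a} \<subset> {k \<in> {1..n}. sort_key n f k \<le> sort_key n f b}"
      by blast
    then have "card {k \<in> {1..n}. sort_key n f k \<le> sort_key n f a} < card {k \<in> {1..n}. sort_key n f k \<le> sort_key n f b}"
      by (intro psubset_card_mono) auto
    then show ?thesis using that by (simp add: rank_def)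
  qed
  have rank_mem: "rank j \<in> {1..n}" if "j \<in> {1..n}" for j
  proof -
    have "card {k \<in> {1..n}. sort_key n f k \<le> sort_key n f j} \<le> card {1..n}" by (intro card_mono) auto
    moreover have "0 < card {k \<in> {1..n}. sort_key n f k \<le> sort_key n f j}"
      using that by (auto simp: card_gt_0_iff)
    ultimately show ?thesis using that by (simp add: rank_def)
  qed
  have inj: "inj_on rank {1..n}"
    using rank_less inj_onD[OF sort_key_inj[of n f]]
    by (intro inj_onI) (metis less_irrefl linorder_neqE_nat)
  have rank_perm: "rank permutes {1..n}"
  proof (rule bij_imp_permutes)
    have "rank ` {1..n} = {1..n}" by (rule endo_inj_surj[OF _ _ inj]) (use rank_mem in auto)
    then show "bij_betw rank {1..n} {1..n}" using inj by (simp add: bij_betw_def)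
    show "rank x = x" if "x \<notin> {1..n}" for x using that by (auto simp: rank_def)
  qed
  show ?thesis
  proof (rule ex1I[of _ "inv rank"])
    have inv_perm: "inv rank permutes {1..n}" using permutes_inv[OF rank_perm] .
    have "sort_key n f (inv rank i) < sort_key n f (inv rank (Suc i))" if "i \<in> {1..<n}" for i
    proof (rule ccontr)
      assume neg: "\<not> ?thesis"
      have mem: "inv rank i \<in> {1..n}" "inv rank (Suc i) \<in> {1..n}"
        using that permutes_in_image[OF inv_perm] by auto
      have rr: "rank (inv rank k) = k" for k using permutes_inverses(1)[OF rank_perm] .
      have "inv rank i \<noteq> inv rank (Suc i)" using rr by (metis n_not_Suc_n)
      then have "sort_key n f (inv rank i) \<noteq> sort_key n f (inv rank (Suc i))"
        using inj_onD[OF sort_key_inj[of n f]] mem by blast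
      then have "sort_key n f (inv rank (Suc i)) < sort_key n f (inv rank i)" using neg by simp
      from rank_less[OF mem(2,1) this] show False unfolding rr by simp
    qed
    then show "inv rank permutes {1..n} \<and> sorts n (inv rank) f"
      using inv_perm by (auto simp: sorts_def)
    fix \<pi> assume \<pi>: "\<pi> permutes {1..n} \<and> sorts n \<pi> f"
    have "rank (\<pi> i) = i" for i
    proof (cases "i \<in> {1..n}")
      case True
      have "{k \<in> {1..n}. sort_key n f k \<le> sort_key n f (\<pi> i)} = \<pi> ` {1..i}"
      proof (intro set_eqI iffI)
        fix k assume "k \<in> {k \<in> {1..n}. sort_key n f k \<le> sort_key n f (\<pi> i)}"
        then have "k \<in> \<pi> ` {1..n}" "sort_key n f k \<le> sort_key n f (\<pi> i)"
          using permutes_image[of \<pi> "{1..n}"] \<pi> by simp_all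
        then obtain j where j: "k = \<pi> j" "j \<in> {1..n}" "sort_key n f (\<pi> j) \<le> sort_key n f (\<pi> i)"
          by blast
        then have "j \<le> i" using sorts_mono[of n \<pi> f i j] \<pi> True by (metis leD not_le_imp_less)
        then show "k \<in> \<pi> ` {1..i}" using j by auto
      next
        fix k assume "k \<in> \<pi> ` {1..i}"
        then obtain j where j: "k = \<pi> j" "1 \<le> j" "j \<le> i" by auto
        then have "sort_key n f (\<pi> j) \<le> sort_key n f (\<pi> i)"
          using sorts_mono[of n \<pi> f j i] \<pi> True by (cases "j = i") auto
        moreover have "\<pi> j \<in> {1..n}" using permutes_in_image[of \<pi> "{1..n}" j] \<pi> j True by auto
        ultimately show "k \<in> {k \<in> {1..n}. sort_key n f k \<le> sort_key n f (\<pi> i)}" using j by simp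
      qed
      moreover have "card (\<pi> ` {1..i}) = i"
        using permutes_inj[of \<pi> "{1..n}"] \<pi> by (subst card_image) (auto intro: inj_on_subset)
      moreover have "\<pi> i \<in> {1..n}" using permutes_in_image[of \<pi> "{1..n}" i] \<pi> True by auto
      ultimately show ?thesis by (simp add: rank_def)
    next
      case False
      then have "\<pi> i = i" using \<pi> permutes_not_in by metis
      then show ?thesis using False by (auto simp: rank_def)
    qed
    then show "\<pi> = inv rank"
      using permutes_inverses(2)[OF rank_perm] by (metis ext)
  qed
qed

text \<open>The bijection reads the word in sorted order. Ties are broken by position, so neighbours
  may be equal exactly where \<open>\<pi>\<close> ascends and must differ at its descents.\<close>

lemma card_sorted_by:
  assumes \<pi>: "\<pi> permutes {1..n}"
  shows "card {f \<in> {1..n} \<rightarrow>\<^sub>E {0..t}. sorts n \<pi> f} = card (chains (\<lambda>i. 0 < i \<and> \<pi> i > \<pi> (Suc i)) n t)"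
    (is "card ?F = card ?C")
proof (rule bij_betw_same_card)
  have mem: "\<pi> i \<in> {1..n} \<longleftrightarrow> i \<in> {1..n}" for i using permutes_in_image[OF \<pi>] .
  have mem': "inv \<pi> i \<in> {1..n} \<longleftrightarrow> i \<in> {1..n}" for i using permutes_in_image[OF permutes_inv[OF \<pi>]] .
  have inv: "\<pi> (inv \<pi> i) = i" "inv \<pi> (\<pi> i) = i" for i using permutes_inverses[OF \<pi>] by auto
  have cond: "sort_key n f (\<pi> i) < sort_key n f (\<pi> (Suc i)) \<longleftrightarrow>
      f (\<pi> i) \<le> f (\<pi> (Suc i)) \<and> (\<pi> i > \<pi> (Suc i) \<longrightarrow> f (\<pi> i) < f (\<pi> (Suc i)))"
    if "i \<in> {1..<n}" for f i
  proof -
    have "\<pi> i \<noteq> \<pi> (Suc i)" using inv(2) by (metis n_not_Suc_n)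
    moreover have "\<pi> i \<le> n" "\<pi> (Suc i) \<le> n" using mem[of i] mem[of "Suc i"] that by auto
    ultimately show ?thesis using sort_key_less_iff[of "\<pi> i" n "\<pi> (Suc i)" f] by auto
  qed
  have le: "g i \<le> t" if g: "g \<in> ?C" and "i \<in> {1..n}" for g i
  proof -
    have "i \<le> n" "1 \<le> i" using that by auto
    then have "g i \<le> g n"
    proof (induction rule: inc_induct)
      case (step k)
      then have "g k \<le> g (Suc k)" "g (Suc k) \<le> g n" using g by (auto simp: chains_def)
      then show ?case by simp
    qed simp
    then show ?thesis using g \<open>1 \<le> i\<close> \<open>i \<le> n\<close> by (auto simp: chains_def)
  qed
  show "bij_betw (\<lambda>f. restrict (f \<circ> \<pi>) {1..n}) ?F ?C"
  proof (rule bij_betw_byWitness[where f' = "\<lambda>g. restrict (g \<circ> inv \<pi>) {1..n}"])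
    show "\<forall>f\<in>?F. restrict (restrict (f \<circ> \<pi>) {1..n} \<circ> inv \<pi>) {1..n} = f"
      using mem' inv by (fastforce simp: fun_eq_iff restrict_def PiE_def extensional_def)
    show "\<forall>g\<in>?C. restrict (restrict (g \<circ> inv \<pi>) {1..n} \<circ> \<pi>) {1..n} = g"
      using mem inv by (fastforce simp: fun_eq_iff restrict_def chains_def extensional_def)
    show "(\<lambda>f. restrict (f \<circ> \<pi>) {1..n}) ` ?F \<subseteq> ?C"
    proof (intro image_subsetI)
      fix f assume f: "f \<in> ?F"
      have "f (\<pi> n) \<le> t" if "0 < n" using f mem[of n] that by (auto simp: PiE_def Pi_def)
      then show "restrict (f \<circ> \<pi>) {1..n} \<in> ?C"
        using f cond[of _ f] by (auto simp: chains_def sorts_def)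
    qed
    show "(\<lambda>g. restrict (g \<circ> inv \<pi>) {1..n}) ` ?C \<subseteq> ?F"
    proof (intro image_subsetI)
      fix g assume g: "g \<in> ?C"
      define f where "f = restrict (g \<circ> inv \<pi>) {1..n}"
      have f\<pi>: "f (\<pi> i) = g i" if "i \<in> {1..n}" for i using that mem[of i] inv by (simp add: f_def)
      have "f \<in> {1..n} \<rightarrow>\<^sub>E {0..t}" using le[OF g] mem' by (auto simp: f_def)
      moreover have "sorts n \<pi> f"
        unfolding sorts_def
      proof
        fix i assume i: "i \<in> {1..<n}"
        then show "sort_key n f (\<pi> i) < sort_key n f (\<pi> (Suc i))"
          using cond[OF i, of f] f\<pi>[of i] f\<pi>[of "Suc i"] g by (auto simp: chains_def)
      qed
      ultimately show "restrict (g \<circ> inv \<pi>) {1..n} \<in> ?F" by (simp add: f_def)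
    qed
  qed
qed

text \<open>The Worpitzky identity as a generating function: each of the \<open>(t + 1)^n\<close>
  words is sorted by exactly one permutation, and by \<open>chain_fps_eq\<close> a permutation with
  k descents accounts for \<open>fps_X^k / (1 - fps_X)^(n + 1)\<close>.\<close>

theorem eulerian_poly_fps:
  "(1 - fps_X) ^ Suc n * Abs_fps (\<lambda>t. real (Suc t ^ n)) = fps_of_poly (eulerian_poly n)"
proof -
  let ?P = "{\<pi>. \<pi> permutes {1..n}}"
  let ?D = "\<lambda>\<pi> i. 0 < i \<and> \<pi> i > \<pi> (Suc i)"
  have finP: "finite ?P" by (rule finite_permutations) simp
  have "Suc t ^ n = (\<Sum>\<pi>\<in>?P. card (chains (?D \<pi>) n t))" for t
  proof -
    have "Suc t ^ n = card ({1..n} \<rightarrow>\<^sub>E {0..t})" by (simp add: card_PiE)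
    also have "{1..n} \<rightarrow>\<^sub>E {0..t} = (\<Union>\<pi>\<in>?P. {f \<in> {1..n} \<rightarrow>\<^sub>E {0..t}. sorts n \<pi> f})"
    proof (intro set_eqI iffI)
      fix f assume "f \<in> {1..n} \<rightarrow>\<^sub>E {0..t}"
      moreover obtain \<pi> where "\<pi> permutes {1..n}" "sorts n \<pi> f" using ex1_sorts[of n f] by blast
      ultimately show "f \<in> (\<Union>\<pi>\<in>?P. {f \<in> {1..n} \<rightarrow>\<^sub>E {0..t}. sorts n \<pi> f})" by blast
    qed auto
    also have "card \<dots> = (\<Sum>\<pi>\<in>?P. card {f \<in> {1..n} \<rightarrow>\<^sub>E {0..t}. sorts n \<pi> f})"
    proof (rule card_UN_disjoint[OF finP])
      show "\<forall>\<pi>\<in>?P. finite {f \<in> {1..n} \<rightarrow>\<^sub>E {0..t}. sorts n \<pi> f}"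
        using finite_PiE[of "{1..n}" "\<lambda>_. {0..t}"] by simp
      have "\<pi> = \<rho>" if "\<pi> permutes {1..n}" "\<rho> permutes {1..n}" "sorts n \<pi> f" "sorts n \<rho> f" for \<pi> \<rho> f
      proof -
        have "(THE \<sigma>. \<sigma> permutes {1..n} \<and> sorts n \<sigma> f) = \<pi>"
          by (rule the1_equality[OF ex1_sorts]) (use that in simp)
        moreover have "(THE \<sigma>. \<sigma> permutes {1..n} \<and> sorts n \<sigma> f) = \<rho>"
          by (rule the1_equality[OF ex1_sorts]) (use that in simp)
        ultimately show ?thesis by simp
      qed
      then show "\<forall>\<pi>\<in>?P. \<forall>\<rho>\<in>?P. \<pi> \<noteq> \<rho> \<longrightarrow> {f \<in> {1..n} \<rightarrow>\<^sub>E {0..t}. sorts n \<pi> f}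
          \<inter> {f \<in> {1..n} \<rightarrow>\<^sub>E {0..t}. sorts n \<rho> f} = {}"
        by blast
    qed
    also have "\<dots> = (\<Sum>\<pi>\<in>?P. card (chains (?D \<pi>) n t))"
      by (intro sum.cong refl card_sorted_by) auto
    finally show ?thesis .
  qed
  then have "Abs_fps (\<lambda>t. real (Suc t ^ n)) = (\<Sum>\<pi>\<in>?P. chain_fps (?D \<pi>) n)"
    by (intro fps_ext) (simp add: fps_sum_nth chain_fps_def del: of_nat_power)
  then have "(1 - fps_X) ^ Suc n * Abs_fps (\<lambda>t. real (Suc t ^ n))
      = (\<Sum>\<pi>\<in>?P. (1 - fps_X) ^ Suc n * chain_fps (?D \<pi>) n)"
    by (simp only: sum_distrib_left)
  also have "\<dots> = (\<Sum>\<pi>\<in>?P. fps_X ^ card {i \<in> {1..<n}. ?D \<pi> i})"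
    by (intro sum.cong refl chain_fps_eq) simp
  also have "\<dots> = (\<Sum>\<pi>\<in>?P. fps_of_poly (monom 1 (des n \<pi>)))"
  proof (intro sum.cong refl)
    fix \<pi> assume "\<pi> \<in> ?P"
    have "{i \<in> {1..<n}. ?D \<pi> i} = {i \<in> {1..<n}. \<pi> i > \<pi> (i + 1)}" by auto
    then show "fps_X ^ card {i \<in> {1..<n}. ?D \<pi> i} = fps_of_poly (monom (1::real) (des n \<pi>))"
      by (simp add: des_def fps_of_poly_monom)
  qed
  finally show ?thesis by (simp add: eulerian_poly_def fps_of_poly_sum)
qed


section \<open>Regular flag triangulations from swaps\<close>

lemma convex_hull_coefficients:
  fixes V :: "'a set" and f :: "'a \<Rightarrow> 'b::real_vector"
  assumes V: "finite V" and f: "inj_on f V"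
  shows "x \<in> convex hull (f ` V) \<longleftrightarrow>
    (\<exists>a. (\<forall>v\<in>V. 0 \<le> a v) \<and> sum a V = 1 \<and> (\<Sum>v\<in>V. a v *\<^sub>R f v) = x)"
proof
  assume "x \<in> convex hull (f ` V)"
  then obtain u where u: "\<forall>y\<in>f ` V. 0 \<le> u y" "sum u (f ` V) = 1" "(\<Sum>y\<in>f ` V. u y *\<^sub>R y) = x"
    using V by (auto simp: convex_hull_finite)
  then show "\<exists>a. (\<forall>v\<in>V. 0 \<le> a v) \<and> sum a V = 1 \<and> (\<Sum>v\<in>V. a v *\<^sub>R f v) = x"
    using f by (intro exI[of _ "u \<circ> f"]) (auto simp: sum.reindex)
next
  assume "\<exists>a. (\<forall>v\<in>V. 0 \<le> a v) \<and> sum a V = 1 \<and> (\<Sum>v\<in>V. a v *\<^sub>R f v) = x"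
  then obtain a where a: "\<forall>v\<in>V. 0 \<le> a v" "sum a V = 1" "(\<Sum>v\<in>V. a v *\<^sub>R f v) = x" by blast
  have "(\<Sum>v\<in>V. a v *\<^sub>R f v) \<in> convex hull (f ` V)"
    by (rule convex_sum[OF V convex_convex_hull a(2)]) (use a in \<open>auto simp: hull_inc\<close>)
  then show "x \<in> convex hull (f ` V)" using a(3) by simp
qed

text \<open>Indicator differences instead of function updates allow the four points to coincide in
  any way.\<close>

lemma sum_fun_upd_swap:
  fixes f :: "'a \<Rightarrow> 'b::real_vector" and a :: "'a \<Rightarrow> real"
  assumes "finite V" "v \<in> V" "w \<in> V" "u \<in> V" "u' \<in> V"
  shows "(\<Sum>x\<in>V. (a x + e * (of_bool (x = u) + of_bool (x = u') - of_bool (x = v) - of_bool (x = w))) *\<^sub>R f x)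
    = (\<Sum>x\<in>V. a x *\<^sub>R f x) + e *\<^sub>R (f u + f u' - f v - f w)"
proof -
  have delta: "(\<Sum>x\<in>V. of_bool (x = y) *\<^sub>R f x) = f y" if "y \<in> V" for y
    using assms(1) that by (simp add: of_bool_def if_distrib[of "\<lambda>c. c *\<^sub>R _"] cong: if_cong)
  have "(\<Sum>x\<in>V. (a x + e * (of_bool (x = u) + of_bool (x = u') - of_bool (x = v) - of_bool (x = w))) *\<^sub>R f x)
    = (\<Sum>x\<in>V. a x *\<^sub>R f x + e *\<^sub>R (of_bool (x = u) *\<^sub>R f x + of_bool (x = u') *\<^sub>R f x
        - of_bool (x = v) *\<^sub>R f x - of_bool (x = w) *\<^sub>R f x))"
    by (intro sum.cong) (simp_all add: algebra_simps)
  then show ?thesis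
    using assms by (simp only: sum.distrib sum_subtractf scaleR_sum_right[symmetric] delta)
qed

text \<open>\<open>swap\<close> keeps non-edges off the lower hull, and \<open>unique\<close>
  separates the cliques. In \<open>unique\<close> the common mass is arbitrary and the two supports
  may be different cliques; the former yields affine independence, the latter the intersections of
  simplices.\<close>

locale regular_flag =
  fixes V :: "(real ^ 'd::finite) set" and E :: "real ^ 'd \<Rightarrow> real ^ 'd \<Rightarrow> bool"
    and h :: "real ^ 'd \<Rightarrow> real"
  assumes finite_V: "finite V"
    and E_refl: "v \<in> V \<Longrightarrow> E v v"
    and swap: "v \<in> V \<Longrightarrow> w \<in> V \<Longrightarrow> \<not> E v w \<Longrightarrow>
      \<exists>u\<in>V. \<exists>u'\<in>V. u + u' = v + w \<and> h u + h u' < h v + h w"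
    and unique: "(\<And>v. v \<in> V \<Longrightarrow> 0 \<le> a v) \<Longrightarrow> (\<And>v. v \<in> V \<Longrightarrow> 0 \<le> b v) \<Longrightarrow>
      (\<And>v w. v \<in> V \<Longrightarrow> w \<in> V \<Longrightarrow> 0 < a v \<Longrightarrow> 0 < a w \<Longrightarrow> E v w) \<Longrightarrow>
      (\<And>v w. v \<in> V \<Longrightarrow> w \<in> V \<Longrightarrow> 0 < b v \<Longrightarrow> 0 < b w \<Longrightarrow> E v w) \<Longrightarrow>
      sum a V = sum b V \<Longrightarrow> (\<Sum>v\<in>V. a v *\<^sub>R v) = (\<Sum>v\<in>V. b v *\<^sub>R v) \<Longrightarrow>
      v \<in> V \<Longrightarrow> a v = b v"
begin

definition cliques :: "(real ^ 'd) set set" where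
  "cliques = {S. S \<subseteq> V \<and> (\<forall>v\<in>S. \<forall>w\<in>S. E v w)}"

definition triangulation :: "(real ^ 'd) set set" where
  "triangulation = (\<lambda>S. convex hull S) ` cliques"

definition lifted_hull :: "((real ^ 'd) \<times> real) set" where
  "lifted_hull = convex hull ((\<lambda>p. (p, h p)) ` V)"

lemma cliques_subset: "S \<in> cliques \<Longrightarrow> S \<subseteq> V"
  and cliques_E: "S \<in> cliques \<Longrightarrow> v \<in> S \<Longrightarrow> w \<in> S \<Longrightarrow> E v w"
  by (auto simp: cliques_def)

lemma cliques_mono: "S \<in> cliques \<Longrightarrow> S' \<subseteq> S \<Longrightarrow> S' \<in> cliques"
  by (auto simp: cliques_def)

lemma finite_clique: "S \<in> cliques \<Longrightarrow> finite S"
  using cliques_subset finite_V finite_subset by blast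

lemma in_lifted_hull_iff:
  "(x, s) \<in> lifted_hull \<longleftrightarrow> (\<exists>a. (\<forall>v\<in>V. 0 \<le> a v) \<and> sum a V = 1 \<and>
     (\<Sum>v\<in>V. a v *\<^sub>R v) = x \<and> (\<Sum>v\<in>V. a v * h v) = s)"
proof -
  have "(\<Sum>v\<in>V. a v *\<^sub>R (v, h v)) = (\<Sum>v\<in>V. a v *\<^sub>R v, \<Sum>v\<in>V. a v * h v)" for a
    by (simp add: prod_eq_iff fst_sum snd_sum)
  then show ?thesis
    unfolding lifted_hull_def
    by (subst convex_hull_coefficients[OF finite_V]) (auto simp: inj_on_def)
qed

text \<open>If a non-edge carried weight at both ends, moving the smaller of the two weights from
  \<open>v\<close> and \<open>w\<close> to \<open>u\<close> and \<open>u'\<close> would keep the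
  point and lower its height.\<close>

lemma minimal_support:
  assumes a: "\<And>v. v \<in> V \<Longrightarrow> 0 \<le> a v" "sum a V = 1" "(\<Sum>v\<in>V. a v *\<^sub>R v) = x"
    and min: "\<And>s. s < (\<Sum>v\<in>V. a v * h v) \<Longrightarrow> (x, s) \<notin> lifted_hull"
    and vw: "v \<in> V" "w \<in> V" "0 < a v" "0 < a w"
  shows "E v w"
proof (rule ccontr)
  assume nE: "\<not> E v w"
  then obtain u u' where u: "u \<in> V" "u' \<in> V" "u + u' = v + w" "h u + h u' < h v + h w"
    using swap vw by blast
  have "v \<noteq> w" using nE E_refl vw by blast
  define e where "e = min (a v) (a w)"
  have e: "0 < e" "e \<le> a v" "e \<le> a w" using vw by (auto simp: e_def)
  define b where "b x = a x + e * (of_bool (x = u) + of_bool (x = u') - of_bool (x = v) - of_bool (x = w))" for x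
  have b: "(\<Sum>x\<in>V. b x *\<^sub>R f x) = (\<Sum>x\<in>V. a x *\<^sub>R f x) + e *\<^sub>R (f u + f u' - f v - f w)"
    for f :: "real ^ 'd \<Rightarrow> 'c::real_vector"
    unfolding b_def by (rule sum_fun_upd_swap) (use finite_V vw u in auto)
  have "\<forall>x\<in>V. 0 \<le> b x"
  proof
    fix x assume "x \<in> V"
    have "0 \<le> e * (of_bool (x = u) + of_bool (x = u'))" using e by simp
    moreover have "e * (of_bool (x = v) + of_bool (x = w)) \<le> a x"
      using a(1)[OF \<open>x \<in> V\<close>] e \<open>v \<noteq> w\<close> by (cases "x = v"; cases "x = w") auto
    ultimately show "0 \<le> b x" by (simp add: b_def algebra_simps)
  qed
  moreover have "sum b V = 1" using b[of "\<lambda>_. 1::real"] a(2) by simp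
  moreover have "(\<Sum>v\<in>V. b v *\<^sub>R v) = x"
  proof -
    have "u + u' - v - w = 0" using u(3) by simp
    then show ?thesis using b[of "\<lambda>v. v"] a(3) by simp
  qed
  ultimately have "(x, \<Sum>v\<in>V. b v * h v) \<in> lifted_hull"
    unfolding in_lifted_hull_iff by blast
  moreover have "(\<Sum>v\<in>V. b v * h v) < (\<Sum>v\<in>V. a v * h v)"
    using b[of h] e(1) u(4) by (simp add: mult_less_0_iff)
  ultimately show False using min by blast
qed

lemma lowest_point:
  assumes "(x, t) \<in> lifted_hull"
  obtains s where "(x, s) \<in> lifted_hull" "\<And>s'. (x, s') \<in> lifted_hull \<Longrightarrow> s \<le> s'"
proof -
  have "compact (lifted_hull \<inter> ({x} \<times> UNIV))"
    unfolding lifted_hull_def using finite_V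
    by (intro compact_Int_closed finite_imp_compact_convex_hull closed_Times) auto
  moreover have "(x, t) \<in> lifted_hull \<inter> ({x} \<times> UNIV)" using assms by simp
  ultimately have "\<exists>z\<in>lifted_hull \<inter> ({x} \<times> UNIV). \<forall>y\<in>lifted_hull \<inter> ({x} \<times> UNIV). snd z \<le> snd y"
    by (intro continuous_attains_inf continuous_on_snd continuous_on_id) auto
  then obtain z where "z \<in> lifted_hull \<inter> ({x} \<times> UNIV)"
    "\<And>y. y \<in> lifted_hull \<inter> ({x} \<times> UNIV) \<Longrightarrow> snd z \<le> snd y"
    by blast
  then show ?thesis using that[of "snd z"] by (cases z) auto
qed

lemma hull_point_lifted:
  assumes "x \<in> convex hull V"
  shows "\<exists>t. (x, t) \<in> lifted_hull"
proof -
  obtain a where "\<forall>v\<in>V. 0 \<le> a v" "sum a V = 1" "(\<Sum>v\<in>V. a v *\<^sub>R v) = x"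
    using assms finite_V by (auto simp: convex_hull_finite)
  then show ?thesis by (auto simp: in_lifted_hull_iff)
qed

text \<open>By compactness there is a lowest lifted point over the common value. Any coefficients of
  it have clique support by \<open>minimal_support\<close>, hence equal \<open>c\<close> by
  \<open>unique\<close>; so \<open>c\<close> attains the minimum and is the only one to do
  so.\<close>

lemma clique_combination_minimal:
  assumes a: "\<And>v. v \<in> V \<Longrightarrow> 0 \<le> a v" "sum a V = 1"
    and c: "\<And>v. v \<in> V \<Longrightarrow> 0 \<le> c v" "sum c V = 1"
      "\<And>v w. v \<in> V \<Longrightarrow> w \<in> V \<Longrightarrow> 0 < c v \<Longrightarrow> 0 < c w \<Longrightarrow> E v w"
    and eq: "(\<Sum>v\<in>V. a v *\<^sub>R v) = (\<Sum>v\<in>V. c v *\<^sub>R v)"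
  shows "(\<Sum>v\<in>V. c v * h v) \<le> (\<Sum>v\<in>V. a v * h v)"
    and "(\<Sum>v\<in>V. a v * h v) \<le> (\<Sum>v\<in>V. c v * h v) \<Longrightarrow> v \<in> V \<Longrightarrow> a v = c v"
proof -
  define x where "x = (\<Sum>v\<in>V. c v *\<^sub>R v)"
  have aL: "(x, \<Sum>v\<in>V. a v * h v) \<in> lifted_hull"
    unfolding in_lifted_hull_iff x_def using a eq by blast
  then obtain s where s: "(x, s) \<in> lifted_hull" "\<And>s'. (x, s') \<in> lifted_hull \<Longrightarrow> s \<le> s'"
    using lowest_point by blast
  have lowest: "b v = c v"
    if b: "\<And>v. v \<in> V \<Longrightarrow> 0 \<le> b v" "sum b V = 1" "(\<Sum>v\<in>V. b v *\<^sub>R v) = x" "(\<Sum>v\<in>V. b v * h v) = s" "v \<in> V"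
    for b v
  proof (rule unique[OF b(1) c(1)])
    show "E v w" if "v \<in> V" "w \<in> V" "0 < b v" "0 < b w" for v w
      by (rule minimal_support[OF b(1-3)]) (use s(2) b(4) that in force)+
  qed (use b c x_def in auto)
  obtain b where b: "\<And>v. v \<in> V \<Longrightarrow> 0 \<le> b v" "sum b V = 1" "(\<Sum>v\<in>V. b v *\<^sub>R v) = x" "(\<Sum>v\<in>V. b v * h v) = s"
    using s(1) unfolding in_lifted_hull_iff by blast
  have "(\<Sum>v\<in>V. c v * h v) = s"
    using lowest[OF b] b(4) by (metis (no_types, lifting) sum.cong)
  then show "(\<Sum>v\<in>V. c v * h v) \<le> (\<Sum>v\<in>V. a v * h v)"
    and "(\<Sum>v\<in>V. a v * h v) \<le> (\<Sum>v\<in>V. c v * h v) \<Longrightarrow> v \<in> V \<Longrightarrow> a v = c v"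
    using s(2)[OF aL] lowest[of a v] a eq by (auto simp: x_def)
qed

lemma clique_hull_coefficients:
  assumes S: "S \<in> cliques"
  shows "x \<in> convex hull S \<longleftrightarrow> (\<exists>c. (\<forall>v\<in>V. 0 \<le> c v) \<and> (\<forall>v\<in>V. 0 < c v \<longrightarrow> v \<in> S) \<and>
    sum c V = 1 \<and> (\<Sum>v\<in>V. c v *\<^sub>R v) = x)"
proof
  assume "x \<in> convex hull S"
  then obtain u where u: "\<forall>v\<in>S. 0 \<le> u v" "sum u S = 1" "(\<Sum>v\<in>S. u v *\<^sub>R v) = x"
    using finite_clique[OF S] by (auto simp: convex_hull_finite)
  define c where "c v = (if v \<in> S then u v else 0)" for v
  have "sum c V = sum u S" "(\<Sum>v\<in>V. c v *\<^sub>R v) = (\<Sum>v\<in>S. u v *\<^sub>R v)"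
    using cliques_subset[OF S] finite_V
    by (auto simp: c_def sum.inter_restrict[symmetric] Int_absorb1
        if_distrib[of "\<lambda>c. c *\<^sub>R _"] cong: if_cong)
  then show "\<exists>c. (\<forall>v\<in>V. 0 \<le> c v) \<and> (\<forall>v\<in>V. 0 < c v \<longrightarrow> v \<in> S) \<and> sum c V = 1 \<and> (\<Sum>v\<in>V. c v *\<^sub>R v) = x"
    using u by (intro exI[of _ c]) (auto simp: c_def)
next
  assume "\<exists>c. (\<forall>v\<in>V. 0 \<le> c v) \<and> (\<forall>v\<in>V. 0 < c v \<longrightarrow> v \<in> S) \<and> sum c V = 1 \<and> (\<Sum>v\<in>V. c v *\<^sub>R v) = x"
  then obtain c where c: "\<forall>v\<in>V. 0 \<le> c v" "\<forall>v\<in>V. 0 < c v \<longrightarrow> v \<in> S" "sum c V = 1" "(\<Sum>v\<in>V. c v *\<^sub>R v) = x"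
    by blast
  have z: "c v = 0" if "v \<in> V - S" for v using c(1,2) that by force
  have "sum c S = 1" "(\<Sum>v\<in>S. c v *\<^sub>R v) = x"
    using c(3,4) z cliques_subset[OF S] finite_V
    by (metis (no_types, lifting) sum.mono_neutral_left scaleR_zero_left)+
  then show "x \<in> convex hull S"
    using finite_clique[OF S] c(1) cliques_subset[OF S] by (auto simp: convex_hull_finite)
qed

lemma coefficient_support_E:
  assumes "S \<in> cliques" "\<forall>v\<in>V. 0 < c v \<longrightarrow> v \<in> S" "v \<in> V" "w \<in> V" "0 < c v" "0 < c w"
  shows "E v w"
  using assms cliques_E by blast

lemma hull_Int:
  assumes S: "S \<in> cliques" and S': "S' \<in> cliques"
  shows "convex hull S \<inter> convex hull S' = convex hull (S \<inter> S')"
proof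
  show "convex hull (S \<inter> S') \<subseteq> convex hull S \<inter> convex hull S'"
    by (simp add: hull_mono)
  show "convex hull S \<inter> convex hull S' \<subseteq> convex hull (S \<inter> S')"
  proof
    fix x assume x: "x \<in> convex hull S \<inter> convex hull S'"
    obtain a where a: "\<forall>v\<in>V. 0 \<le> a v" "\<forall>v\<in>V. 0 < a v \<longrightarrow> v \<in> S" "sum a V = 1" "(\<Sum>v\<in>V. a v *\<^sub>R v) = x"
      using x clique_hull_coefficients[OF S] by auto
    obtain b where b: "\<forall>v\<in>V. 0 \<le> b v" "\<forall>v\<in>V. 0 < b v \<longrightarrow> v \<in> S'" "sum b V = 1" "(\<Sum>v\<in>V. b v *\<^sub>R v) = x"
      using x clique_hull_coefficients[OF S'] by auto
    have "a v = b v" if "v \<in> V" for v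
      by (rule unique)
        (use a b that coefficient_support_E[OF S a(2)] coefficient_support_E[OF S' b(2)] in auto)
    then have "\<forall>v\<in>V. 0 < a v \<longrightarrow> v \<in> S \<inter> S'" using a b by auto
    moreover have "S \<inter> S' \<in> cliques" using S cliques_mono by blast
    ultimately show "x \<in> convex hull (S \<inter> S')"
      using clique_hull_coefficients[of "S \<inter> S'"] a by blast
  qed
qed

text \<open>The positive and the negative part of an affine relation are two combinations of one
  clique with equal mass and equal value, so they coincide.\<close>

lemma clique_affine_independent:
  assumes S: "S \<in> cliques"
  shows "\<not> affine_dependent S"
proof
  assume "affine_dependent S"
  then obtain u where u: "sum u S = 0" "\<exists>v\<in>S. u v \<noteq> 0" "(\<Sum>v\<in>S. u v *\<^sub>R v) = 0"
    using finite_clique[OF S] by (auto simp: affine_dependent_explicit_finite)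
  define a where "a v = (if v \<in> S then max 0 (u v) else 0)" for v
  define b where "b v = (if v \<in> S then max 0 (- u v) else 0)" for v
  have ab: "a v - b v = (if v \<in> S then u v else 0)" for v by (auto simp: a_def b_def)
  have "sum a V - sum b V = 0" "(\<Sum>v\<in>V. a v *\<^sub>R v) - (\<Sum>v\<in>V. b v *\<^sub>R v) = 0"
    using u cliques_subset[OF S] finite_V
    by (auto simp: sum_subtractf[symmetric] scaleR_left_diff_distrib[symmetric] ab
        sum.inter_restrict[symmetric] Int_absorb1 if_distrib[of "\<lambda>c. c *\<^sub>R _"] cong: if_cong)
  then have "a v = b v" if "v \<in> V" for v
    using that by (intro unique[of a b])
      (auto simp: a_def b_def split: if_splits intro: cliques_E[OF S])
  then have "u v = 0" if "v \<in> S" for v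
    using ab[of v] that cliques_subset[OF S] by auto
  then show False using u(2) by blast
qed

lemma vertices_clique: "S \<in> cliques \<Longrightarrow> vertices (convex hull S) = S"
  using extreme_point_of_convex_hull_affine_independent[OF clique_affine_independent]
  by (auto simp: vertices_def)

lemma singleton_clique: "v \<in> V \<Longrightarrow> {v} \<in> cliques"
  by (auto simp: cliques_def E_refl)

lemma vertex_set_triangulation: "vertex_set triangulation = V"
proof
  show "vertex_set triangulation \<subseteq> V"
    using vertices_clique cliques_subset by (auto simp: vertex_set_def triangulation_def)
  show "V \<subseteq> vertex_set triangulation"
    using singleton_clique vertices_clique by (fastforce simp: vertex_set_def triangulation_def)
qed

lemma is_face_triangulation_iff: "is_face triangulation \<sigma> \<longleftrightarrow> \<sigma> \<in> cliques"
  using vertices_clique by (auto simp: is_face_def triangulation_def)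

lemma simplicial_complex_triangulation: "simplicial_complex triangulation"
  unfolding simplicial_complex_def
proof (intro conjI ballI allI impI)
  have "finite cliques"
    using finite_V by (auto simp: cliques_def intro: finite_subset[of _ "Pow V"])
  then show "finite triangulation" by (simp add: triangulation_def)
next
  fix S assume "S \<in> triangulation"
  then obtain A where A: "A \<in> cliques" "S = convex hull A" by (auto simp: triangulation_def)
  then show "\<exists>n. n simplex S"
    using clique_affine_independent
    by (intro exI[of _ "int (card A) - 1"]) (auto simp: simplex_def intro!: exI[of _ A])
next
  fix F S assume "S \<in> triangulation \<and> F face_of S"
  then obtain A where A: "A \<in> cliques" "F face_of convex hull A" by (auto simp: triangulation_def)
  then show "F \<in> triangulation"
    using face_of_convex_hull_affine_independent[OF clique_affine_independent] cliques_mono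
    unfolding triangulation_def by blast
next
  fix S S' assume "S \<in> triangulation \<and> S' \<in> triangulation"
  then obtain A B where A: "A \<in> cliques" "S = convex hull A" and B: "B \<in> cliques" "S' = convex hull B"
    by (auto simp: triangulation_def)
  then show "S \<inter> S' face_of S"
    using face_of_convex_hull_affine_independent[OF clique_affine_independent[OF A(1)]] hull_Int by auto
qed

lemma Union_triangulation: "\<Union>triangulation = convex hull V"
proof
  show "\<Union>triangulation \<subseteq> convex hull V"
    unfolding triangulation_def using cliques_subset hull_mono by blast
  show "convex hull V \<subseteq> \<Union>triangulation"
  proof
    fix x assume "x \<in> convex hull V"
    then obtain t where "(x, t) \<in> lifted_hull" using hull_point_lifted by blast
    then obtain s where s: "(x, s) \<in> lifted_hull" "\<And>s'. (x, s') \<in> lifted_hull \<Longrightarrow> s \<le> s'"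
      using lowest_point by blast
    obtain b where b: "\<And>v. v \<in> V \<Longrightarrow> 0 \<le> b v" "sum b V = 1" "(\<Sum>v\<in>V. b v *\<^sub>R v) = x" "(\<Sum>v\<in>V. b v * h v) = s"
      using s(1) unfolding in_lifted_hull_iff by blast
    have "(x, s') \<notin> lifted_hull" if "s' < (\<Sum>v\<in>V. b v * h v)" for s'
      using s(2)[of s'] b(4) that by auto
    then have clique: "{v \<in> V. 0 < b v} \<in> cliques"
      unfolding cliques_def using minimal_support[OF b(1-3)] by simp
    have "x \<in> convex hull {v \<in> V. 0 < b v}"
      unfolding clique_hull_coefficients[OF clique] using b by (intro exI[of _ b]) auto
    then show "x \<in> \<Union>triangulation" using clique by (auto simp: triangulation_def)
  qed
qed

text \<open>The faces are the cliques of a graph: a non-face contains two points that are not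
  joined, and by minimality nothing else.\<close>

lemma flag_triangulation: "flag triangulation"
  unfolding flag_def
proof (intro allI impI)
  fix \<sigma> assume "minimal_nonface triangulation \<sigma>"
  then have \<sigma>: "\<sigma> \<subseteq> V" "\<sigma> \<notin> cliques" "\<And>\<tau>. \<tau> \<subset> \<sigma> \<Longrightarrow> \<tau> \<in> cliques"
    by (auto simp: minimal_nonface_def vertex_set_triangulation is_face_triangulation_iff)
  then obtain v w where vw: "v \<in> \<sigma>" "w \<in> \<sigma>" "\<not> E v w"
    by (auto simp: cliques_def)
  then have "{v, w} \<notin> cliques" by (auto simp: cliques_def)
  then have "\<sigma> = {v, w}" using \<sigma>(3)[of "{v, w}"] vw by auto
  moreover have "v \<noteq> w" using vw \<sigma>(1) E_refl by blast
  ultimately show "card \<sigma> = 2" by simp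
qed

text \<open>A face is the hull of some of the lifted points. A non-edge among them would, by a swap,
  put a point of the hull strictly below the midpoint of its lift.\<close>

lemma lower_face_clique:
  assumes F: "lower_face_of F lifted_hull"
  obtains S where "S \<in> cliques" "fst ` F = convex hull S"
proof -
  have face: "F face_of lifted_hull" and low: "\<And>x t s. (x, t) \<in> F \<Longrightarrow> s < t \<Longrightarrow> (x, s) \<notin> lifted_hull"
    using F by (auto simp: lower_face_of_def)
  have "compact ((\<lambda>p. (p, h p)) ` V)" using finite_V by (simp add: finite_imp_compact)
  then obtain W where W: "W \<subseteq> (\<lambda>p. (p, h p)) ` V" "F = convex hull W"
    using face_of_convex_hull_subset face unfolding lifted_hull_def by blast
  define S where "S = fst ` W"
  have WS: "W = (\<lambda>p. (p, h p)) ` S" and SV: "S \<subseteq> V"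
    using W(1) by (force simp: S_def image_iff)+
  have "E v w" if vw: "v \<in> S" "w \<in> S" for v w
  proof (rule ccontr)
    assume nE: "\<not> E v w"
    then obtain u u' where u: "u \<in> V" "u' \<in> V" "u + u' = v + w" "h u + h u' < h v + h w"
      using swap[of v w] vw SV by blast
    have mid: "(1/2) *\<^sub>R (p, h p) + (1/2) *\<^sub>R (q, h q) = ((1/2) *\<^sub>R (p + q), (h p + h q) / 2)" for p q
      by (simp add: scaleR_right_distrib add_divide_distrib)
    have "(1/2) *\<^sub>R (v, h v) + (1/2) *\<^sub>R (w, h w) \<in> F"
      unfolding W(2) by (rule convexD[OF convex_convex_hull]) (use vw WS in \<open>auto intro!: hull_inc\<close>)
    moreover have "(1/2) *\<^sub>R (u, h u) + (1/2) *\<^sub>R (u', h u') \<in> lifted_hull"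
      unfolding lifted_hull_def
      by (rule convexD[OF convex_convex_hull]) (use u in \<open>auto intro!: hull_inc\<close>)
    ultimately show False
      unfolding mid u(3) using low u(4) by fastforce
  qed
  then have "S \<in> cliques" using SV by (auto simp: cliques_def)
  moreover have "fst ` F = convex hull S"
    unfolding W(2) S_def by (rule convex_hull_linear_image) (rule linear_fst)
  ultimately show ?thesis using that by blast
qed

lemma clique_lower_face:
  assumes S: "S \<in> cliques"
  defines "F \<equiv> convex hull ((\<lambda>p. (p, h p)) ` S)"
  shows "lower_face_of F lifted_hull" "fst ` F = convex hull S"
proof -
  have coeff: "\<exists>c. (\<forall>v\<in>V. 0 \<le> c v) \<and> (\<forall>v\<in>V. 0 < c v \<longrightarrow> v \<in> S) \<and> sum c V = 1 \<and>
      (\<Sum>v\<in>V. c v *\<^sub>R v) = fst z \<and> (\<Sum>v\<in>V. c v * h v) = snd z" if "z \<in> F" for z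
  proof -
    obtain u where u: "\<forall>v\<in>S. 0 \<le> u v" "sum u S = 1" "(\<Sum>v\<in>S. u v *\<^sub>R (v, h v)) = z"
      using convex_hull_coefficients[OF finite_clique[OF S], of "\<lambda>p. (p, h p)"] \<open>z \<in> F\<close>
      unfolding F_def by (auto simp: inj_on_def)
    have z: "(\<Sum>v\<in>S. u v *\<^sub>R v) = fst z" "(\<Sum>v\<in>S. u v * h v) = snd z"
      using u(3) by (auto simp: fst_sum snd_sum)
    define c where "c v = (if v \<in> S then u v else 0)" for v
    have "sum c V = sum u S" "(\<Sum>v\<in>V. c v *\<^sub>R v) = (\<Sum>v\<in>S. u v *\<^sub>R v)" "(\<Sum>v\<in>V. c v * h v) = (\<Sum>v\<in>S. u v * h v)"
      using cliques_subset[OF S] finite_V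
      by (auto simp: c_def sum.inter_restrict[symmetric] Int_absorb1
          if_distrib[of "\<lambda>c. c *\<^sub>R _"] if_distrib[of "\<lambda>c. c * _"] cong: if_cong)
    then show ?thesis using u z by (intro exI[of _ c]) (auto simp: c_def)
  qed
  have FL: "F \<subseteq> lifted_hull"
    unfolding F_def lifted_hull_def using cliques_subset[OF S] by (intro hull_mono) auto
  have low: "(x, s) \<notin> lifted_hull" if xt: "(x, t) \<in> F" and st: "s < t" for x s t
  proof
    assume "(x, s) \<in> lifted_hull"
    then obtain a where a: "\<forall>v\<in>V. 0 \<le> a v" "sum a V = 1" "(\<Sum>v\<in>V. a v *\<^sub>R v) = x" "(\<Sum>v\<in>V. a v * h v) = s"
      by (auto simp: in_lifted_hull_iff)
    obtain c where c: "\<forall>v\<in>V. 0 \<le> c v" "\<forall>v\<in>V. 0 < c v \<longrightarrow> v \<in> S" "sum c V = 1"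
      "(\<Sum>v\<in>V. c v *\<^sub>R v) = x" "(\<Sum>v\<in>V. c v * h v) = t"
      using coeff[OF xt] by auto
    have "(\<Sum>v\<in>V. c v * h v) \<le> (\<Sum>v\<in>V. a v * h v)"
      by (rule clique_combination_minimal(1))
        (use a c coefficient_support_E[OF S c(2)] in auto)
    then show False using a c st by simp
  qed
  have "p \<in> F \<and> q \<in> F"
    if pq: "p \<in> lifted_hull" "q \<in> lifted_hull" "z \<in> F" "z \<in> open_segment p q" for p q z
  proof -
    obtain r where r: "0 < r" "r < 1" "z = (1 - r) *\<^sub>R p + r *\<^sub>R q"
      using pq(4) by (auto simp: in_segment)
    obtain a where a: "\<forall>v\<in>V. 0 \<le> a v" "sum a V = 1" "(\<Sum>v\<in>V. a v *\<^sub>R v) = fst p" "(\<Sum>v\<in>V. a v * h v) = snd p"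
      using pq(1) in_lifted_hull_iff[of "fst p" "snd p"] by auto
    obtain b where b: "\<forall>v\<in>V. 0 \<le> b v" "sum b V = 1" "(\<Sum>v\<in>V. b v *\<^sub>R v) = fst q" "(\<Sum>v\<in>V. b v * h v) = snd q"
      using pq(2) in_lifted_hull_iff[of "fst q" "snd q"] by auto
    obtain c where c: "\<forall>v\<in>V. 0 \<le> c v" "\<forall>v\<in>V. 0 < c v \<longrightarrow> v \<in> S" "sum c V = 1"
      "(\<Sum>v\<in>V. c v *\<^sub>R v) = fst z" "(\<Sum>v\<in>V. c v * h v) = snd z"
      using coeff[OF pq(3)] by auto
    \<comment> \<open>The coefficients of \<open>z\<close> inherited from \<open>p\<close> and
      \<open>q\<close>. They attain the height of the clique combination \<open>c\<close>, so they
      equal it; as \<open>0 < r < 1\<close>, the supports of \<open>a\<close> and \<open>b\<close>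
      then lie in \<open>S\<close>, which puts \<open>p\<close> and \<open>q\<close> into
      \<open>F\<close>.\<close>
    define e where "e v = (1 - r) * a v + r * b v" for v
    have e: "sum e V = 1" "(\<Sum>v\<in>V. e v *\<^sub>R v) = fst z" "(\<Sum>v\<in>V. e v * h v) = snd z"
    proof -
      have "sum e V = (1 - r) * sum a V + r * sum b V"
        by (simp add: e_def sum.distrib sum_distrib_left)
      then show "sum e V = 1" using a b by simp
      have "(\<Sum>v\<in>V. e v *\<^sub>R v) = (1 - r) *\<^sub>R (\<Sum>v\<in>V. a v *\<^sub>R v) + r *\<^sub>R (\<Sum>v\<in>V. b v *\<^sub>R v)"
        by (simp add: e_def sum.distrib scaleR_sum_right scaleR_left_distrib)
      then show "(\<Sum>v\<in>V. e v *\<^sub>R v) = fst z" using a b r(3) by simp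
      have "(\<Sum>v\<in>V. e v * h v) = (1 - r) * (\<Sum>v\<in>V. a v * h v) + r * (\<Sum>v\<in>V. b v * h v)"
        by (simp add: e_def sum.distrib sum_distrib_left distrib_right mult.assoc)
      then show "(\<Sum>v\<in>V. e v * h v) = snd z" using a b r(3) by simp
    qed
    have e0: "0 \<le> e v" if "v \<in> V" for v using a b r that by (simp add: e_def)
    have "e v = c v" if "v \<in> V" for v
      by (rule clique_combination_minimal(2)[of e c])
        (use e e0 c coefficient_support_E[OF S c(2)] that in auto)
    then have supp: "v \<in> S" if "v \<in> V" "0 < a v \<or> 0 < b v" for v
    proof -
      have "0 < e v" using that a b r
        by (auto simp: e_def intro: add_pos_nonneg add_nonneg_pos)
      then show ?thesis using c(2) that \<open>\<And>v. v \<in> V \<Longrightarrow> e v = c v\<close> by simp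
    qed
    have inF: "y \<in> F"
      if f: "\<forall>v\<in>V. 0 \<le> f v" "sum f V = 1" "(\<Sum>v\<in>V. f v *\<^sub>R v) = fst y" "(\<Sum>v\<in>V. f v * h v) = snd y"
        "\<And>v. v \<in> V \<Longrightarrow> 0 < f v \<Longrightarrow> v \<in> S" for f y
    proof -
      have z: "f v = 0" if "v \<in> V - S" for v using f(1) f(5)[of v] that by force
      have restrict: "(\<Sum>v\<in>V. f v *\<^sub>R g v) = (\<Sum>v\<in>S. f v *\<^sub>R g v)"
        for g :: "real ^ 'd \<Rightarrow> 'c::real_vector"
        by (rule sum.mono_neutral_right) (use finite_V cliques_subset[OF S] z in auto)
      have "sum f S = 1" "(\<Sum>v\<in>S. f v *\<^sub>R (v, h v)) = y"
        using f(2-4) restrict[of "\<lambda>_. 1::real"] restrict[of h] restrict[of "\<lambda>v. v"]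
        by (auto simp: prod_eq_iff fst_sum snd_sum)
      moreover have "\<forall>v\<in>S. 0 \<le> f v" using f(1) cliques_subset[OF S] by auto
      ultimately show ?thesis
        unfolding F_def by (subst convex_hull_coefficients[OF finite_clique[OF S]]) (auto simp: inj_on_def)
    qed
    show ?thesis using inF[OF a] inF[OF b] supp by blast
  qed
  then have "F face_of lifted_hull"
    unfolding face_of_def using FL convex_convex_hull[of "(\<lambda>p. (p, h p)) ` S"] F_def by blast
  then show "lower_face_of F lifted_hull"
    using low by (auto simp: lower_face_of_def)
  have "fst ` F = convex hull (fst ` (\<lambda>p. (p, h p)) ` S)"
    unfolding F_def by (rule convex_hull_linear_image) (rule linear_fst)
  then show "fst ` F = convex hull S" by (simp add: image_image)
qed

lemma regular_triangulation: "regular triangulation"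
proof -
  have "triangulation = {fst ` F |F. lower_face_of F lifted_hull}"
  proof (intro set_eqI iffI)
    fix S assume "S \<in> triangulation"
    then show "S \<in> {fst ` F |F. lower_face_of F lifted_hull}"
      using clique_lower_face by (fastforce simp: triangulation_def)
  next
    fix S assume "S \<in> {fst ` F |F. lower_face_of F lifted_hull}"
    then show "S \<in> triangulation"
      using lower_face_clique by (force simp: triangulation_def)
  qed
  then show ?thesis
    unfolding regular_def vertex_set_triangulation lifted_hull_def by (rule exI[of _ h])
qed

end


section \<open>Volume of unimodular simplices\<close>

text \<open>The library computes the volume of a simplex only over well-ordered index types.\<close>

typedef ('n::finite) idx = "{..<CARD('n)}"
  by (intro exI[of _ 0]) simp

lemma bij_Rep_idx: "bij_betw Rep_idx (UNIV :: 'n::finite idx set) {..<CARD('n)}"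
  by (intro bij_betwI[of _ _ _ Abs_idx])
    (use Rep_idx in \<open>auto simp: Abs_idx_inverse Rep_idx_inverse\<close>)

instantiation idx :: (finite) wellorder
begin

definition less_eq_idx :: "'a idx \<Rightarrow> 'a idx \<Rightarrow> bool" where "x \<le> y \<longleftrightarrow> Rep_idx x \<le> Rep_idx y"
definition less_idx :: "'a idx \<Rightarrow> 'a idx \<Rightarrow> bool" where "x < y \<longleftrightarrow> Rep_idx x < Rep_idx y"

instance
proof
  fix P :: "'a idx \<Rightarrow> bool" and a
  assume step: "\<And>x. (\<And>y. y < x \<Longrightarrow> P y) \<Longrightarrow> P x"
  show "P a"
  proof (induction a rule: measure_induct_rule[of Rep_idx])
    case (less x)
    show ?case by (rule step) (rule less, simp add: less_idx_def)
  qed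
qed (auto simp: less_eq_idx_def less_idx_def Rep_idx_inject)

end

instance idx :: (finite) finite
  by standard (use bij_betw_finite[OF bij_Rep_idx] in simp)

lemma card_idx: "CARD('n::finite idx) = CARD('n)"
  using bij_betw_same_card[OF bij_Rep_idx] by simp

lemma prod_Basis_cart: "(\<Prod>b\<in>Basis. f ((x :: real ^ 'n) \<bullet> b)) = (\<Prod>i\<in>UNIV. f (x $ i))"
proof -
  have "(Basis :: (real ^ 'n) set) = (\<lambda>i. axis i 1) ` UNIV"
    by (auto simp: Basis_vec_def)
  moreover have "inj (\<lambda>i. axis i 1 :: real ^ 'n)"
    by (auto simp: inj_on_def axis_eq_axis)
  ultimately have "prod g Basis = (\<Prod>i\<in>UNIV. g (axis i 1))" for g :: "real ^ 'n \<Rightarrow> 'a"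
    using prod.reindex[of "\<lambda>i. axis i 1 :: real ^ 'n" UNIV g] by simp
  then show ?thesis by (simp add: inner_axis)
qed

text \<open>Preimages of boxes are boxes with permuted side lengths, and Lebesgue measure is
  determined by the volumes of boxes.\<close>

lemma lborel_distr_reindex:
  fixes e :: "'m::finite \<Rightarrow> 'n::finite"
  assumes e: "bij e"
  shows "distr lborel borel (\<lambda>x :: real ^ 'n. \<chi> i. x $ e i) = lborel"
proof (rule lborel_eqI[symmetric])
  let ?\<phi> = "\<lambda>x :: real ^ 'n. \<chi> i. x $ e i"
  have "continuous_on UNIV ?\<phi>" by (intro continuous_intros)
  then have [measurable]: "?\<phi> \<in> borel_measurable borel"
    by (rule borel_measurable_continuous_onI)
  fix l u :: "real ^ 'm" assume le: "\<And>b. b \<in> Basis \<Longrightarrow> l \<bullet> b \<le> u \<bullet> b"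
  have le': "l $ i \<le> u $ i" for i
    using le[of "axis i 1"] by (simp add: inner_axis axis_in_Basis_iff)
  define l' u' where "l' = (\<chi> j. l $ inv e j)" and "u' = (\<chi> j. u $ inv e j)"
  have inv: "inv e (e i) = i" "e (inv e j) = j" for i j
    using e by (auto simp: bij_is_inj bij_is_surj surj_f_inv_f)
  have "?\<phi> -` box l u = box l' u'"
    by (auto simp: mem_box_cart l'_def u'_def) (metis inv)+
  then have "emeasure (distr lborel borel ?\<phi>) (box l u) = emeasure lborel (box l' u')"
    by (simp add: emeasure_distr)
  also have "\<dots> = ennreal (\<Prod>b\<in>Basis. (u' - l') \<bullet> b)"
    by (rule emeasure_lborel_box) (auto simp: Basis_vec_def inner_axis l'_def u'_def le')
  also have "(\<Prod>b\<in>Basis. (u' - l') \<bullet> b) = (\<Prod>j\<in>UNIV. u $ inv e j - l $ inv e j)"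
    using prod_Basis_cart[of "\<lambda>x. x" "u' - l'"] by (simp add: l'_def u'_def)
  also have "\<dots> = (\<Prod>i\<in>UNIV. u $ i - l $ i)"
    by (rule prod.reindex_bij_betw) (rule bij_imp_bij_inv[OF e])
  also have "\<dots> = (\<Prod>b\<in>Basis. (u - l) \<bullet> b)"
    using prod_Basis_cart[of "\<lambda>x. x" "u - l"] by simp
  finally show "emeasure (distr lborel borel ?\<phi>) (box l u) = ennreal (\<Prod>b\<in>Basis. (u - l) \<bullet> b)" .
qed simp

lemma det_Ints: "(\<And>i j. A $ i $ j \<in> \<int>) \<Longrightarrow> det (A :: real ^ 'n ^ 'n) \<in> \<int>"
  unfolding det_def by (intro Ints_sum Ints_mult Ints_prod) auto

lemma measure_lebesgue_hull:
  fixes X :: "(real ^ 'n::finite) set"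
  assumes "finite X"
  shows "measure lebesgue (convex hull X) = measure lborel (convex hull X)"
  using finite_imp_compact_convex_hull[OF assms]
  by (intro measure_completion) (auto dest: compact_imp_closed)

text \<open>The matrix of edge vectors is integral, and the combinations yielding the unit vectors
  form an integral right inverse. So its determinant is 1 or -1.\<close>

lemma unimodular_simplex_measure_wellorder:
  fixes X :: "(real ^ 'n::{finite,wellorder}) set"
  assumes X: "finite X" "card X = Suc CARD('n)" "x\<^sub>0 \<in> X"
    and int: "\<And>x i. x \<in> X \<Longrightarrow> x $ i - x\<^sub>0 $ i \<in> \<int>"
    and gen: "\<And>i. \<exists>b. (\<forall>x\<in>X. b x \<in> \<int>) \<and> (\<Sum>x\<in>X. b x *\<^sub>R (x - x\<^sub>0)) = axis i 1"
  shows "measure lborel (convex hull X) = 1 / fact CARD('n)"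
proof -
  have "card (UNIV :: 'n set) = card (X - {x\<^sub>0})" using X by simp
  then obtain f where f: "bij_betw f (UNIV :: 'n set) (X - {x\<^sub>0})"
    using finite_same_card_bij[of "UNIV :: 'n set" "X - {x\<^sub>0}"] X by auto
  obtain b where b: "\<And>i x. x \<in> X \<Longrightarrow> b i x \<in> \<int>" "\<And>i. (\<Sum>x\<in>X. b i x *\<^sub>R (x - x\<^sub>0)) = axis i 1"
    using gen by metis
  define M where "M = (\<chi> i. \<chi> j. f j $ i - x\<^sub>0 $ i)"
  define N where "N = (\<chi> j. \<chi> k. b k (f j))"
  have fX: "f j \<in> X" for j using f by (auto simp: bij_betw_def)
  have "M ** N = mat 1"
  proof -
    have "(\<Sum>j\<in>UNIV. (f j $ i - x\<^sub>0 $ i) * b k (f j)) = (if i = k then 1 else 0)" for i k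
    proof -
      have "(\<Sum>j\<in>UNIV. (f j $ i - x\<^sub>0 $ i) * b k (f j)) = (\<Sum>x\<in>X - {x\<^sub>0}. (x $ i - x\<^sub>0 $ i) * b k x)"
        using sum.reindex_bij_betw[OF f, of "\<lambda>x. (x $ i - x\<^sub>0 $ i) * b k x"] .
      also have "\<dots> = (\<Sum>x\<in>X. (x $ i - x\<^sub>0 $ i) * b k x)"
        using X by (intro sum.mono_neutral_left) auto
      also have "\<dots> = (\<Sum>x\<in>X. b k x *\<^sub>R (x - x\<^sub>0)) $ i"
        by (simp add: mult.commute)
      finally show ?thesis unfolding b(2) by (simp add: axis_def)
    qed
    then show ?thesis
      by (simp add: M_def N_def matrix_matrix_mult_def mat_def vec_eq_iff)
  qed
  then have "det M * det N = 1" by (metis det_I det_mul)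
  moreover have "det M \<in> \<int>" "det N \<in> \<int>"
    using int[OF fX] b(1)[OF fX] by (auto intro!: det_Ints simp: M_def N_def)
  then obtain m k where "det M = of_int m" "det N = of_int k" by (metis Ints_cases)
  ultimately have "m * k = 1" by (metis of_int_eq_1_iff of_int_mult)
  then have "\<bar>m\<bar> = 1" by (metis abs_1 abs_mult abs_zmult_eq_1)
  then have "\<bar>det M\<bar> = 1" using \<open>det M = of_int m\<close> by (metis of_int_1 of_int_abs)
  then show ?thesis using content_simplex[OF X f] by (simp add: M_def)
qed

text \<open>Transfers the well-ordered case along a renumbering of the coordinates, which preserves
  hulls, lattice conditions and volume.\<close>

lemma unimodular_simplex_measure:
  fixes X :: "(real ^ 'n::finite) set"
  assumes X: "finite X" "card X = Suc CARD('n)" "x\<^sub>0 \<in> X"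
    and int: "\<And>x i. x \<in> X \<Longrightarrow> x $ i - x\<^sub>0 $ i \<in> \<int>"
    and gen: "\<And>i. \<exists>b. (\<forall>x\<in>X. b x \<in> \<int>) \<and> (\<Sum>x\<in>X. b x *\<^sub>R (x - x\<^sub>0)) = axis i 1"
  shows "measure lebesgue (convex hull X) = 1 / fact CARD('n)"
proof -
  obtain e :: "'n idx \<Rightarrow> 'n" where e: "bij e"
    using finite_same_card_bij[of "UNIV :: 'n idx set" "UNIV :: 'n set"] card_idx[where 'n = 'n] by auto
  define \<phi> where "\<phi> = (\<lambda>x :: real ^ 'n. \<chi> i. x $ e i)"
  have lin: "linear \<phi>" by (rule linearI) (auto simp: \<phi>_def vec_eq_iff)
  have inj: "inj \<phi>"
  proof (rule injI)
    fix x y assume "\<phi> x = \<phi> y"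
    then have "x $ e i = y $ e i" for i by (simp add: \<phi>_def vec_eq_iff)
    then show "x = y" using e by (metis bij_pointE vec_eq_iff)
  qed
  have "measure lborel (convex hull (\<phi> ` X)) = 1 / fact CARD('n idx)"
  proof (rule unimodular_simplex_measure_wellorder)
    show "finite (\<phi> ` X)" "\<phi> x\<^sub>0 \<in> \<phi> ` X" using X by auto
    show "card (\<phi> ` X) = Suc CARD('n idx)"
      using X(2) inj by (simp add: card_image card_idx inj_on_subset)
    show "x $ i - \<phi> x\<^sub>0 $ i \<in> \<int>" if "x \<in> \<phi> ` X" for x i
      using that int by (auto simp: \<phi>_def)
    fix i
    obtain b where b: "\<forall>x\<in>X. b x \<in> \<int>" "(\<Sum>x\<in>X. b x *\<^sub>R (x - x\<^sub>0)) = axis (e i) 1"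
      using gen by blast
    have "(\<Sum>y\<in>\<phi> ` X. b (inv \<phi> y) *\<^sub>R (y - \<phi> x\<^sub>0)) = (\<Sum>x\<in>X. b x *\<^sub>R (\<phi> x - \<phi> x\<^sub>0))"
      using inj by (subst sum.reindex[OF inj_on_subset[OF inj subset_UNIV]]) simp
    also have "\<dots> = \<phi> (\<Sum>x\<in>X. b x *\<^sub>R (x - x\<^sub>0))"
      using lin by (simp add: linear_sum linear_scale linear_diff)
    also have "\<dots> = axis i 1"
      using e unfolding b(2) by (auto simp: \<phi>_def axis_def vec_eq_iff bij_def inj_eq)
    finally show "\<exists>b. (\<forall>y\<in>\<phi> ` X. b y \<in> \<int>) \<and> (\<Sum>y\<in>\<phi> ` X. b y *\<^sub>R (y - \<phi> x\<^sub>0)) = axis i 1"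
      using b(1) inj by (intro exI[of _ "\<lambda>y. b (inv \<phi> y)"]) auto
  qed
  also have "convex hull (\<phi> ` X) = \<phi> ` (convex hull X)"
    by (rule convex_hull_linear_image[OF lin, symmetric])
  also have "measure lborel (\<phi> ` (convex hull X)) = measure (distr lborel borel \<phi>) (\<phi> ` (convex hull X))"
    unfolding \<phi>_def lborel_distr_reindex[OF e] ..
  also have "\<dots> = measure lborel (\<phi> -` \<phi> ` (convex hull X) \<inter> space lborel)"
  proof (rule measure_distr)
    have "continuous_on UNIV \<phi>" unfolding \<phi>_def by (intro continuous_intros)
    then show "\<phi> \<in> measurable lborel borel"
      using borel_measurable_continuous_onI by simp
    have "compact (\<phi> ` (convex hull X))"
      using linear_continuous_on[OF lin[unfolded linear_conv_bounded_linear]]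
        finite_imp_compact_convex_hull[OF X(1)] compact_continuous_image by blast
    then show "\<phi> ` (convex hull X) \<in> sets borel" by (simp add: borel_compact)
  qed
  also have "\<phi> -` \<phi> ` (convex hull X) \<inter> space lborel = convex hull X"
    using inj by (simp add: inj_vimage_image_eq)
  finally show ?thesis
    using measure_lebesgue_hull[OF X(1)] by (simp add: card_idx)
qed

context regular_flag
begin

lemma unimodular_triangulation:
  assumes lattice: "V \<subseteq> lattice_points"
    and gen: "\<And>S i. S \<in> cliques \<Longrightarrow> (\<And>S'. S' \<in> cliques \<Longrightarrow> S \<subseteq> S' \<Longrightarrow> S' = S) \<Longrightarrow>
      S \<noteq> {} \<and> (\<exists>b. (\<forall>v\<in>S. b v \<in> \<int>) \<and> sum b S = 0 \<and> (\<Sum>v\<in>S. b v *\<^sub>R v) = axis i 1)"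
  shows "unimodular triangulation"
  unfolding unimodular_def
proof (intro ballI impI)
  fix P assume P: "P \<in> triangulation" and mx: "\<forall>P'\<in>triangulation. P \<subseteq> P' \<longrightarrow> P' = P"
  obtain S where S: "S \<in> cliques" "P = convex hull S" using P by (auto simp: triangulation_def)
  have "S' = S" if "S' \<in> cliques" "S \<subseteq> S'" for S'
  proof -
    have "convex hull S' \<in> triangulation" using that(1) by (auto simp: triangulation_def)
    moreover have "P \<subseteq> convex hull S'" unfolding S(2) by (rule hull_mono[OF that(2)])
    ultimately have "convex hull S' = convex hull S" using mx S(2) by blast
    then show ?thesis using vertices_clique[OF that(1)] vertices_clique[OF S(1)] by metis
  qed
  note g = gen[OF S(1) this]
  obtain v\<^sub>0 where v\<^sub>0: "v\<^sub>0 \<in> S" using g by blast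
  have comb: "\<exists>b. (\<forall>v\<in>S. b v \<in> \<int>) \<and> (\<Sum>v\<in>S. b v *\<^sub>R (v - v\<^sub>0)) = axis i 1" for i
  proof -
    obtain b where b: "\<forall>v\<in>S. b v \<in> \<int>" "sum b S = 0" "(\<Sum>v\<in>S. b v *\<^sub>R v) = axis i 1"
      using g by blast
    have "(\<Sum>v\<in>S. b v *\<^sub>R (v - v\<^sub>0)) = axis i 1"
      using b(2,3) by (simp add: scaleR_right_diff_distrib sum_subtractf scaleR_sum_left[symmetric])
    then show ?thesis using b(1) by blast
  qed
  \<comment> \<open>The unit vectors are combinations of edge vectors, so the clique has full affine
    dimension; with affine independence this gives the \<open>CARD('d) + 1\<close> vertices that the
    volume formula asks for.\<close>
  have "span {v - v\<^sub>0 |v. v \<in> S - {v\<^sub>0}} = UNIV"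
  proof -
    have "axis i 1 \<in> span {v - v\<^sub>0 |v. v \<in> S - {v\<^sub>0}}" for i
    proof -
      obtain b where b: "(\<Sum>v\<in>S. b v *\<^sub>R (v - v\<^sub>0)) = axis i 1" using comb by blast
      have "b v *\<^sub>R (v - v\<^sub>0) \<in> span {v - v\<^sub>0 |v. v \<in> S - {v\<^sub>0}}" if "v \<in> S" for v
      proof (cases "v = v\<^sub>0")
        case False
        then have "v - v\<^sub>0 \<in> {v - v\<^sub>0 |v. v \<in> S - {v\<^sub>0}}" using that by blast
        then show ?thesis by (intro span_scale span_base)
      qed (simp add: span_zero)
      then show ?thesis unfolding b[symmetric] by (intro span_sum) auto
    qed
    then have "Basis \<subseteq> span {v - v\<^sub>0 |v. v \<in> S - {v\<^sub>0}}" by (auto simp: Basis_vec_def)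
    then have "span Basis \<subseteq> span {v - v\<^sub>0 |v. v \<in> S - {v\<^sub>0}}"
      by (rule span_minimal[OF _ subspace_span])
    then show ?thesis by (simp only: span_Basis) blast
  qed
  then have "x \<in> affine hull S" for x
    unfolding affine_hull_span[OF v\<^sub>0] by (intro CollectI exI[of _ "x - v\<^sub>0"]) simp
  then have "affine hull S = UNIV" by blast
  then have "aff_dim S = int CARD('d)"
    using aff_dim_affine_hull[of S] by simp
  then have "card S = Suc CARD('d)"
    using aff_dim_affine_independent[OF clique_affine_independent[OF S(1)]] by simp
  then have "measure lebesgue (convex hull S) = 1 / fact CARD('d)"
  proof (rule unimodular_simplex_measure[OF finite_clique[OF S(1)] _ v\<^sub>0])
    show "v $ i - v\<^sub>0 $ i \<in> \<int>" if "v \<in> S" for v i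
    proof -
      have "v \<in> lattice_points" "v\<^sub>0 \<in> lattice_points"
        using that v\<^sub>0 cliques_subset[OF S(1)] lattice by auto
      then show ?thesis by (auto simp: lattice_points_def)
    qed
  qed (rule comb)
  then show "fact CARD('d) * measure lebesgue P = 1" using S(2) by simp
qed

end


section \<open>The simplices\<close>

lemma valid_entry_less: "valid B \<Longrightarrow> 0 < entry B (Suc i) \<Longrightarrow> entry B (Suc i) < entry B i"
proof (induction B arbitrary: i)
  case (Cons a B)
  then show ?case by (cases i) (auto simp: low_eq_entry)
qed simp

lemma valid_eqI: "valid B \<Longrightarrow> valid C \<Longrightarrow> (\<And>i. entry B i = entry C i) \<Longrightarrow> B = C"
proof (induction B arbitrary: C)
  case Nil
  show ?case
  proof (cases C)
    case (Cons b D)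
    then show ?thesis using Nil(2) Nil(3)[of 0] low_pos[of D] by simp
  qed simp
next
  case (Cons a B)
  show ?case
  proof (cases C)
    case Nil
    then show ?thesis using Cons.prems(1) Cons.prems(3)[of 0] low_pos[of B] by simp
  next
    case (Cons b D)
    have "entry B i = entry D i" for i using Cons.prems(3)[of "Suc i"] Cons by simp
    then show ?thesis using Cons.IH[of D] Cons.prems Cons Cons.prems(3)[of 0] by simp
  qed
qed

lemma words_entry_le:
  assumes "B \<in> words d" shows "entry B i \<le> d + 1 - i"
proof (induction i)
  case 0
  then show ?case using assms by (simp add: words_def low_eq_entry)
next
  case (Suc i)
  then show ?case using valid_entry_less[of B i] assms
    by (cases "entry B (Suc i) = 0") (auto simp: words_def)
qed

lemma valid_rev_upt: "1 \<le> a \<Longrightarrow> valid (rev [a..<b]) \<and> low (rev [a..<b]) \<le> max 1 b"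
  by (induction b) auto

lemma real_mult_Suc_le_iff: "real b * (real k + 1) \<le> real a * real k \<longleftrightarrow> b * (k + 1) \<le> a * k"
proof -
  have "real b * (real k + 1) = real (b * (k + 1))" "real a * real k = real (a * k)"
    by (auto simp: algebra_simps)
  then show ?thesis by (simp only: of_nat_le_iff)
qed

section \<open>Height coordinates and the points coded by words\<close>

locale coordinate_numbering =
  fixes c :: "'d::finite \<Rightarrow> nat" and d :: nat
  assumes bij: "bij_betw c UNIV {1..d}"
begin

definition coord :: "nat \<Rightarrow> 'd" where "coord = inv_into UNIV c"

lemma c_mem: "1 \<le> c i" "c i \<le> d"
  using bij by (auto simp: bij_betw_def)

lemma coord_c [simp]: "coord (c i) = i"
  using bij by (simp add: coord_def bij_betw_def)

lemma c_coord [simp]: "1 \<le> k \<Longrightarrow> k \<le> d \<Longrightarrow> c (coord k) = k"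
  using bij by (simp add: coord_def bij_betw_def f_inv_into_f)

lemma card_index: "CARD('d) = d"
  using bij_betw_same_card[OF bij] by simp

text \<open>The unimodular coordinates \<open>y\<^sub>k = (t - x\<^sub>1) + \<dots> + (t - x\<^sub>k)\<close>, in which the \<open>t\<close>-th
  dilate of the simplex becomes \<open>0 \<le> y\<^sub>1 / 2 \<le> y\<^sub>2 / 3 \<le> \<dots> \<le> y\<^sub>d / (d + 1) \<le> t\<close>.\<close>

definition height :: "real \<Rightarrow> real ^ 'd \<Rightarrow> nat \<Rightarrow> real" where
  "height t x k = (\<Sum>j=1..k. t - x $ coord j)"

lemma height_0 [simp]: "height t x 0 = 0"
  and height_Suc: "height t x (Suc k) = height t x k + (t - x $ coord (Suc k))"
  by (auto simp: height_def)

lemma height_inject: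
  assumes "\<And>k. k \<le> d \<Longrightarrow> height t x k = height t y k"
  shows "x = y"
proof (rule vec_eq_iff[THEN iffD2], intro allI)
  fix i
  obtain k where k: "c i = Suc k" using c_mem[of i] by (cases "c i") auto
  then show "x $ i = y $ i"
    using assms[of "Suc k"] assms[of k] c_mem[of i] coord_c[of i] by (simp add: height_Suc)
qed

lemma height_sum:
  "height (sum a W) (\<Sum>w\<in>W. a w *\<^sub>R f w) k = (\<Sum>w\<in>W. a w * height 1 (f w) k)"
proof (induction k)
  case (Suc k)
  have "sum a W - (\<Sum>w\<in>W. a w *\<^sub>R f w) $ coord (Suc k) = (\<Sum>w\<in>W. a w * (1 - f w $ coord (Suc k)))"
    by (simp add: right_diff_distrib sum_subtractf)
  then show ?case using Suc by (simp add: height_Suc distrib_left sum.distrib)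
qed simp

lemma height_scale: "height (t * s) (t *\<^sub>R x) k = t * height s x k"
  by (simp add: height_def sum_distrib_left right_diff_distrib)

text \<open>The inverse of the height coordinates: \<open>x_k = t - (y_k - y_(k-1))\<close>, where
  \<open>y_k\<close> stands at position \<open>d - k\<close> of the word and \<open>y_0 = 0\<close>
  lies beyond its end.\<close>

definition point :: "real \<Rightarrow> nat list \<Rightarrow> real ^ 'd" where
  "point t B = (\<chi> i. t - (real (entry B (d - c i)) - real (entry B (Suc (d - c i)))))"

lemma point_lattice: "point (real t) B \<in> lattice_points"
  by (auto simp: point_def lattice_points_def)

lemma height_point:
  assumes "length B \<le> d" "k \<le> d"
  shows "height t (point t B) k = real (entry B (d - k))"
  using assms(2)
proof (induction k)
  case 0
  then show ?case using assms(1) by (simp add: entry_beyond)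
next
  case (Suc k)
  then have "Suc (d - Suc k) = d - k" by simp
  then show ?case using Suc by (simp add: height_Suc point_def)
qed

lemma height_point_1: "B \<in> words d \<Longrightarrow> k \<le> d \<Longrightarrow> height 1 (point 1 B) k = real (entry B (d - k))"
  using height_point[of B k 1] by (simp add: words_def)

lemma point_combination_entries:
  assumes "sum a (words d) = sum b (words d)"
    and "(\<Sum>B\<in>words d. a B *\<^sub>R point 1 B) = (\<Sum>B\<in>words d. b B *\<^sub>R point 1 B)"
  shows "(\<Sum>B\<in>words d. a B * entry B i) = (\<Sum>B\<in>words d. b B * entry B i)"
proof (cases "i \<le> d")
  case True
  have "(\<Sum>B\<in>words d. f B * height 1 (point 1 B) (d - i)) = (\<Sum>B\<in>words d. f B * entry B i)" for f
    using True by (intro sum.cong) (auto simp: height_point_1)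
  then show ?thesis
    using height_sum[of a "words d" "point 1" "d - i"] height_sum[of b "words d" "point 1" "d - i"] assms
    by simp
next
  case False
  then have "entry B i = 0" if "B \<in> words d" for B
    using that by (auto simp: words_def intro: entry_beyond)
  then show ?thesis by simp
qed

lemma inj_point: "inj_on (point 1) (words d)"
proof (rule inj_onI)
  fix B C assume BC: "B \<in> words d" "C \<in> words d" "point 1 B = point 1 C"
  have "entry B i = entry C i" for i
  proof (cases "i \<le> d")
    case True
    then show ?thesis
      using height_point_1[OF BC(1), of "d - i"] height_point_1[OF BC(2), of "d - i"] BC(3) by simp
  next
    case False
    then show ?thesis using BC by (simp add: words_def entry_beyond)
  qed
  then show "B = C" using BC valid_eqI by (auto simp: words_def)
qed

section \<open>Vertices and inequalities of the simplex\<close>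

lemma height_vertex:
  assumes "k \<le> d"
  shows "height 1 (Q_vertex c m) k = (if 1 \<le> m \<and> m \<le> k then real k + 1 else 0)"
  using assms
proof (induction k)
  case (Suc k)
  then show ?case by (auto simp: height_Suc Q_vertex_def)
qed simp

text \<open>The weights of the vertices are thus the increments of \<open>y_k / (k + 1)\<close>,
  which turns their nonnegativity into the lecture hall inequalities.\<close>

lemma vertex_combination_height:
  assumes "k \<le> d"
  shows "height (sum u {0..d}) (\<Sum>m\<in>{0..d}. u m *\<^sub>R Q_vertex c m) k = (real k + 1) * (\<Sum>m=1..k. u m)"
proof -
  have "height (sum u {0..d}) (\<Sum>m\<in>{0..d}. u m *\<^sub>R Q_vertex c m) k
      = (\<Sum>m\<in>{0..d}. if 1 \<le> m \<and> m \<le> k then u m * (real k + 1) else 0)"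
    unfolding height_sum using height_vertex[OF assms] by (intro sum.cong) auto
  also have "\<dots> = (\<Sum>m=1..k. u m * (real k + 1))"
    using assms by (intro sum.mono_neutral_cong_right) auto
  finally show ?thesis by (simp add: sum_distrib_right[symmetric] mult.commute)
qed

lemma vertex_relation_trivial:
  assumes "sum u {0..d} = 0" "(\<Sum>m\<in>{0..d}. u m *\<^sub>R Q_vertex c m) = 0" "m \<le> d"
  shows "u m = 0"
proof -
  have part: "(\<Sum>m=1..k. u m) = 0" if "k \<le> d" for k
    using vertex_combination_height[OF that, of u] assms(1,2) by (simp add: height_def)
  have pos: "u k = 0" if "1 \<le> k" "k \<le> d" for k
    using part[of k] part[of "k - 1"] that by (cases k) auto
  have "u 0 + (\<Sum>m=1..d. u m) = 0"
    using assms(1) by (simp add: sum.atLeast_Suc_atMost)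
  then show ?thesis using pos[of m] part[of d] assms(3) by (cases "m = 0") auto
qed

lemma inj_vertex: "inj_on (Q_vertex c) {0..d}"
proof (rule inj_onI, rule ccontr)
  fix l m assume lm: "l \<in> {0..d}" "m \<in> {0..d}" "Q_vertex c l = Q_vertex c m" "l \<noteq> m"
  define u where "u j = (if j = l then 1 else 0) - (if j = m then 1 else (0::real))" for j
  have "u l = 0"
    by (rule vertex_relation_trivial)
      (use lm in \<open>auto simp: u_def sum_subtractf scaleR_left_diff_distrib
        if_distrib[of "\<lambda>r. r *\<^sub>R _"] cong: if_cong\<close>)
  then show False using lm by (simp add: u_def)
qed

lemma vertices_affine_independent: "\<not> affine_dependent (Q_vertex c ` {0..d})"
proof
  assume "affine_dependent (Q_vertex c ` {0..d})"
  then obtain u where u: "sum u (Q_vertex c ` {0..d}) = 0" "\<exists>v\<in>Q_vertex c ` {0..d}. u v \<noteq> 0"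
    "(\<Sum>v\<in>Q_vertex c ` {0..d}. u v *\<^sub>R v) = 0"
    by (auto simp: affine_dependent_explicit_finite)
  have "sum (u \<circ> Q_vertex c) {0..d} = 0" "(\<Sum>m\<in>{0..d}. (u \<circ> Q_vertex c) m *\<^sub>R Q_vertex c m) = 0"
    using u(1,3) by (simp_all add: sum.reindex[OF inj_vertex] comp_def)
  then have "(u \<circ> Q_vertex c) m = 0" if "m \<le> d" for m
    using vertex_relation_trivial that by blast
  then show False using u(2) by auto
qed

lemma Q_simplex: "int d simplex Q c (Suc d)"
  unfolding simplex_def Q_def
  using vertices_affine_independent inj_vertex
  by (intro exI[of _ "Q_vertex c ` {0..d}"]) (simp add: card_image)

lemma in_Q_iff:
  "x \<in> Q c (Suc d) \<longleftrightarrow>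
    (\<forall>k\<in>{1..d}. height 1 x (k - 1) * (real k + 1) \<le> height 1 x k * real k) \<and> height 1 x d \<le> real d + 1"
    (is "_ \<longleftrightarrow> ?R")
proof -
  have "x \<in> Q c (Suc d) \<longleftrightarrow>
      (\<exists>u. (\<forall>m\<in>{0..d}. 0 \<le> u m) \<and> sum u {0..d} = 1 \<and> (\<Sum>m\<in>{0..d}. u m *\<^sub>R Q_vertex c m) = x)"
    unfolding Q_def using convex_hull_coefficients[OF _ inj_vertex] by simp
  also have "\<dots> \<longleftrightarrow> ?R"
  proof
    assume "\<exists>u. (\<forall>m\<in>{0..d}. 0 \<le> u m) \<and> sum u {0..d} = 1 \<and> (\<Sum>m\<in>{0..d}. u m *\<^sub>R Q_vertex c m) = x"
    then obtain u where u0: "\<forall>m\<in>{0..d}. 0 \<le> u m"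
      and u': "sum u {0..d} = 1" "(\<Sum>m\<in>{0..d}. u m *\<^sub>R Q_vertex c m) = x"
      by blast
    have u: "\<And>m. m \<le> d \<Longrightarrow> 0 \<le> u m" "sum u {0..d} = 1" "(\<Sum>m\<in>{0..d}. u m *\<^sub>R Q_vertex c m) = x"
      using u0 u' by auto
    have h: "height 1 x k = (real k + 1) * (\<Sum>m=1..k. u m)" if "k \<le> d" for k
      using vertex_combination_height[OF that, of u] u by simp
    have "height 1 x (k - 1) * (real k + 1) \<le> height 1 x k * real k" if k: "k \<in> {1..d}" for k
    proof -
      obtain l where l: "k = Suc l" using k by (cases k) auto
      have "(\<Sum>m=1..l. u m) \<le> (\<Sum>m=1..k. u m)" using u(1)[of k] k l by simp
      then have "(real k * (real k + 1)) * (\<Sum>m=1..l. u m) \<le> (real k * (real k + 1)) * (\<Sum>m=1..k. u m)"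
        by (intro mult_left_mono) auto
      moreover have "height 1 x k = (real k + 1) * (\<Sum>m=1..k. u m)" using h k by simp
      moreover have "height 1 x (k - 1) = real k * (\<Sum>m=1..l. u m)"
        using h[of l] k l by (simp add: add.commute)
      ultimately show ?thesis by (simp only: mult_ac)
    qed
    moreover have "(\<Sum>m=1..d. u m) \<le> sum u {0..d}"
      using u(1) by (intro sum_mono2) auto
    then have "height 1 x d \<le> real d + 1"
      using h[of d] u(2) mult_left_mono[of "\<Sum>m=1..d. u m" 1 "real d + 1"] by simp
    ultimately show ?R by blast
  next
    assume R: ?R
    \<comment> \<open>Barycentric coordinates solved from \<open>vertex_combination_height\<close>:
      increments of the quotients \<open>y_k / (k + 1)\<close>, with the rest of the total 1 on
      vertex 0.\<close>
    define u where "u m = (if m = 0 then 1 - height 1 x d / (real d + 1)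
      else height 1 x m / (real m + 1) - height 1 x (m - 1) / real m)" for m
    have part: "(\<Sum>m=1..k. u m) = height 1 x k / (real k + 1)" for k
      by (induction k) (auto simp: u_def)
    have "sum u {0..d} = u 0 + (\<Sum>m=1..d. u m)" by (simp add: sum.atLeast_Suc_atMost)
    then have s: "sum u {0..d} = 1" unfolding part by (simp add: u_def)
    have "0 \<le> u m" if "m \<le> d" for m
    proof (cases "m = 0")
      case False
      then have "height 1 x (m - 1) * (real m + 1) \<le> height 1 x m * real m" using R that by auto
      then show ?thesis using False by (simp add: u_def field_simps)
    qed (use R in \<open>simp add: u_def\<close>)
    moreover have "(\<Sum>m\<in>{0..d}. u m *\<^sub>R Q_vertex c m) = x"
    proof (rule height_inject[of 1])
      show "height 1 (\<Sum>m\<in>{0..d}. u m *\<^sub>R Q_vertex c m) k = height 1 x k" if "k \<le> d" for k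
        using vertex_combination_height[OF that, of u] s part[of k] by simp
    qed
    ultimately show "\<exists>u. (\<forall>m\<in>{0..d}. 0 \<le> u m) \<and> sum u {0..d} = 1 \<and> (\<Sum>m\<in>{0..d}. u m *\<^sub>R Q_vertex c m) = x"
      using s by (intro exI[of _ u]) auto
  qed
  finally show ?thesis .
qed

lemma vertex_is_point:
  assumes "m \<le> d" shows "Q_vertex c m \<in> point 1 ` words d"
proof (cases "m = 0")
  case True
  then have "Q_vertex c m = point 1 []" by (simp add: Q_vertex_def point_def vec_eq_iff)
  then show ?thesis by simp
next
  case False
  \<comment> \<open>The \<open>m\<close>-th vertex has heights \<open>k + 1\<close> from
    \<open>k = m\<close> on and 0 before, so its word is
    \<open>d + 1, d, \<dots>, m + 1\<close>.\<close>
  define B where "B = rev [m + 1..<d + 2]"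
  have B: "B \<in> words d"
    using valid_rev_upt[of "m + 1" "d + 2"] False by (auto simp: words_def B_def)
  have entry: "entry B i = (if i \<le> d - m then d + 1 - i else 0)" for i
    using assms by (auto simp: B_def entry_def rev_nth simp del: upt_Suc)
  have "Q_vertex c m = point 1 B"
  proof (rule height_inject[of 1])
    show "height 1 (Q_vertex c m) k = height 1 (point 1 B) k" if "k \<le> d" for k
      using height_vertex[OF that, of m] height_point_1[OF B that] entry[of "d - k"] that assms False
      by (auto simp: of_nat_diff)
  qed
  then show ?thesis using B by blast
qed

lemma hull_points: "convex hull (point 1 ` words d) = Q c (Suc d)"
proof
  have "Q_vertex c ` {0..d} \<subseteq> point 1 ` words d" using vertex_is_point by auto
  then show "Q c (Suc d) \<subseteq> convex hull (point 1 ` words d)"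
    unfolding Q_def by (simp add: hull_mono)
  have "point 1 B \<in> Q c (Suc d)" if B: "B \<in> words d" for B
    unfolding in_Q_iff
  proof (intro conjI ballI)
    fix k assume k: "k \<in> {1..d}"
    define a b where "a = entry B (d - k)" and "b = entry B (Suc (d - k))"
    \<comment> \<open>For \<open>b > 0\<close> the word drops strictly, and its letters are bounded
      by \<open>a \<le> k + 1\<close>. So \<open>b * (k + 1)\<close> is at most
      \<open>a * (k + 1) - (k + 1)\<close>, hence at most \<open>a * k\<close>.\<close>
    have "b * (k + 1) \<le> a * k"
    proof (cases "b = 0")
      case False
      then have "b + 1 \<le> a" using valid_entry_less[of B "d - k"] B by (auto simp: a_def b_def words_def)
      moreover have "a \<le> k + 1" using words_entry_le[OF B, of "d - k"] k by (simp add: a_def)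
      moreover have "(b + 1) * (k + 1) \<le> a * (k + 1)"
        using \<open>b + 1 \<le> a\<close> by (rule mult_le_mono1)
      ultimately show ?thesis by (simp add: algebra_simps)
    qed simp
    then have "real b * (real k + 1) \<le> real a * real k"
      by (simp only: real_mult_Suc_le_iff)
    moreover have "Suc (d - k) = d - (k - 1)" using k by auto
    ultimately show "height 1 (point 1 B) (k - 1) * (real k + 1) \<le> height 1 (point 1 B) k * real k"
      using height_point_1[OF B, of k] height_point_1[OF B, of "k - 1"] k by (simp add: a_def b_def)
  next
    show "height 1 (point 1 B) d \<le> real d + 1"
      using height_point_1[OF B, of d] words_entry_le[OF B, of 0] by simp
  qed
  moreover have "convex (Q c (Suc d))" by (simp add: Q_def)
  ultimately show "convex hull (point 1 ` words d) \<subseteq> Q c (Suc d)"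
    by (intro hull_minimal) auto
qed

lemma Q_lattice_polytope: "lattice_polytope (Q c (Suc d))"
  unfolding lattice_polytope_def hull_points[symmetric]
  by (intro exI[of _ "point 1 ` words d"]) (use point_lattice[of 1] in auto)

section \<open>Lattice points of dilates and the delta-polynomial\<close>

lemma in_dilate_iff:
  assumes "1 \<le> t"
  shows "z \<in> (\<lambda>x. real t *\<^sub>R x) ` Q c (Suc d) \<longleftrightarrow>
    (\<forall>k\<in>{1..d}. height t z (k - 1) * (real k + 1) \<le> height t z k * real k) \<and> height t z d \<le> t * (real d + 1)"
proof -
  have "z \<in> (\<lambda>x. real t *\<^sub>R x) ` Q c (Suc d) \<longleftrightarrow> (1 / real t) *\<^sub>R z \<in> Q c (Suc d)"
    using assms by (auto simp: image_iff intro!: bexI[of _ "(1 / real t) *\<^sub>R z"])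
  moreover have "height 1 ((1 / real t) *\<^sub>R z) k = height t z k / real t" for k
    using height_scale[of "1 / real t" "real t" z k] assms by simp
  moreover have "a / real t * x \<le> b / real t * y \<longleftrightarrow> a * x \<le> b * y" "a / real t \<le> x \<longleftrightarrow> a \<le> real t * x"
    for a b x y using assms by (auto simp: field_simps)
  ultimately show ?thesis by (simp only: in_Q_iff)
qed

text \<open>Lattice points have integral heights, and the inequalities make them nonnegative upwards
  from \<open>y_0 = 0\<close>. Read from the top they form a lecture hall sequence of full length
  \<open>d\<close>, zeros included.\<close>

lemma dilate_lattice_points:
  assumes t: "1 \<le> t"
  shows "(\<lambda>x. real t *\<^sub>R x) ` Q c (Suc d) \<inter> lattice_points = point (real t) ` hall d (t * Suc d)"
proof (intro set_eqI iffI)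
  fix z assume z: "z \<in> (\<lambda>x. real t *\<^sub>R x) ` Q c (Suc d) \<inter> lattice_points"
  then have cond: "\<And>k. 1 \<le> k \<Longrightarrow> k \<le> d \<Longrightarrow> height t z (k - 1) * (real k + 1) \<le> height t z k * real k"
    "height t z d \<le> t * (real d + 1)"
    using in_dilate_iff[OF t] by auto
  have nonneg: "0 \<le> height t z k" if "k \<le> d" for k
    using that
  proof (induction k)
    case (Suc k)
    then have "0 \<le> height t z k * (real (Suc k) + 1)" by simp
    also have "\<dots> \<le> height t z (Suc k) * real (Suc k)" using cond(1)[of "Suc k"] Suc by simp
    finally show ?case by (simp add: zero_le_mult_iff)
  qed simp
  have ints: "height t z k \<in> \<int>" for k
    using z by (auto simp: height_def lattice_points_def)
  define y where "y k = nat \<lfloor>height t z k\<rfloor>" for k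
  have y: "height t z k = real (y k)" if "k \<le> d" for k
    using nonneg[OF that] ints[of k] by (auto simp: y_def elim!: Ints_cases)
  have y0: "y 0 = 0" using y[of 0] by simp
  define B where "B = map (\<lambda>i. y (d - i)) [0..<d]"
  have entry: "entry B (d - k) = y k" if "k \<le> d" for k
    using that y0 by (cases "k = 0") (auto simp: B_def entry_def)
  have "B \<in> hall d (t * Suc d)"
    unfolding in_hall_iff
  proof (intro conjI allI impI)
    show "length B = d" by (simp add: B_def)
    have "real (y d) \<le> real (t * Suc d)" using cond(2) y[of d] by (simp add: algebra_simps)
    then have "y d \<le> t * Suc d" by (simp only: of_nat_le_iff)
    then show "entry B 0 \<le> t * Suc d" using entry[of d] by simp
    fix i assume i: "Suc i < d"
    have "real (y (d - i - 1)) * (real (d - i) + 1) \<le> real (y (d - i)) * real (d - i)"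
      using cond(1)[of "d - i"] y[of "d - i - 1"] y[of "d - i"] i by simp
    then have "y (d - i - 1) * (d - i + 1) \<le> y (d - i) * (d - i)"
      by (simp only: real_mult_Suc_le_iff)
    then show "entry B (Suc i) * (d - i + 1) \<le> entry B i * (d - i)"
      using entry[of "d - i - 1"] entry[of "d - i"] i by simp
  qed
  moreover have "point (real t) B = z"
  proof (rule height_inject[of "real t"])
    show "height (real t) (point (real t) B) k = height (real t) z k" if "k \<le> d" for k
      using height_point[of B k "real t"] entry[OF that] y[OF that] that by (simp add: B_def)
  qed
  ultimately show "z \<in> point (real t) ` hall d (t * Suc d)" by blast
next
  fix z assume "z \<in> point (real t) ` hall d (t * Suc d)"
  then obtain B where B: "B \<in> hall d (t * Suc d)" "z = point (real t) B" by blast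
  have h: "height t z k = real (entry B (d - k))" if "k \<le> d" for k
    using height_point[of B k "real t"] B that by (simp add: in_hall_iff)
  have "height t z (k - 1) * (real k + 1) \<le> height t z k * real k" if k: "k \<in> {1..d}" for k
  proof (cases "k = 1")
    case False
    then have "entry B (Suc (d - k)) * (k + 1) \<le> entry B (d - k) * k"
      using B(1) k unfolding in_hall_iff by (auto dest!: spec[of _ "d - k"])
    then have "real (entry B (Suc (d - k))) * (real k + 1) \<le> real (entry B (d - k)) * real k"
      by (simp only: real_mult_Suc_le_iff)
    moreover have "Suc (d - k) = d - (k - 1)" using k by auto
    ultimately show ?thesis using h[of k] h[of "k - 1"] k by simp
  qed (use h k in simp)
  moreover have "height t z d \<le> t * (real d + 1)"
  proof -
    have "entry B 0 \<le> t * Suc d" using B(1) by (simp add: in_hall_iff)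
    then have "real (entry B 0) \<le> real (t * Suc d)" by (simp only: of_nat_le_iff)
    then show ?thesis using h[of d] by (simp add: algebra_simps)
  qed
  ultimately show "z \<in> (\<lambda>x. real t *\<^sub>R x) ` Q c (Suc d) \<inter> lattice_points"
    using in_dilate_iff[OF t] point_lattice B(2) by blast
qed

lemma ehrhart_count_Q:
  assumes "1 \<le> t"
  shows "real (ehrhart_count (Q c (Suc d)) t) = real (Suc t ^ Suc d) - real (t ^ Suc d)"
proof -
  have inj: "inj_on (point (real t)) (hall d (t * Suc d))"
  proof (rule inj_onI)
    fix B C assume BC: "B \<in> hall d (t * Suc d)" "C \<in> hall d (t * Suc d)" "point (real t) B = point (real t) C"
    then have len: "length B = d" "length C = d" by (auto simp: in_hall_iff)
    show "B = C"
    proof (rule nth_equalityI)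
      fix i assume "i < length B"
      then show "B ! i = C ! i"
        using height_point[of B "d - i" "real t"] height_point[of C "d - i" "real t"] len BC(3) by (simp add: entry_def)
    qed (simp add: len)
  qed
  then have "int (ehrhart_count (Q c (Suc d)) t) = (int t + 1) ^ Suc d - int t ^ Suc d"
    unfolding ehrhart_count_def dilate_lattice_points[OF assms] card_image[OF inj]
    by (intro card_hall_dilate)
  then have "real_of_int (int (ehrhart_count (Q c (Suc d)) t)) = real_of_int ((int t + 1) ^ Suc d - int t ^ Suc d)"
    by (simp only:)
  then show ?thesis by (simp add: algebra_simps)
qed

lemma ehrhart_series_Q:
  "ehrhart_series (Q c (Suc d)) * (1 - fps_X) ^ Suc d = fps_of_poly (eulerian_poly (Suc d))"
proof -
  \<comment> \<open>The counts are differences of consecutive powers, and the constant term is 1 on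
    both sides. The factor \<open>1 - fps_X\<close> lowers the exponent of the Eulerian identity to
    \<open>Suc d\<close>.\<close>
  have "ehrhart_series (Q c (Suc d)) = (1 - fps_X) * Abs_fps (\<lambda>t. real (Suc t ^ Suc d))"
  proof (rule fps_ext)
    fix t
    show "fps_nth (ehrhart_series (Q c (Suc d))) t = fps_nth ((1 - fps_X) * Abs_fps (\<lambda>t. real (Suc t ^ Suc d))) t"
      using ehrhart_count_Q[of t]
      by (cases t) (auto simp: ehrhart_series_def left_diff_distrib simp del: power_Suc of_nat_power)
  qed
  then show ?thesis
    using eulerian_poly_fps[of "Suc d"] by (simp add: mult_ac)
qed

lemma delta_poly_Q: "delta_poly (Q c (Suc d)) = eulerian_poly (Suc d)"
proof -
  define U :: "real fps" where "U = (1 - fps_X) ^ Suc d"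
  have U0: "fps_nth U 0 \<noteq> 0" by (simp add: U_def fps_nth_power_0)
  have eq: "ehrhart_series (Q c (Suc d)) = fps_of_poly p / U \<longleftrightarrow> p = eulerian_poly (Suc d)" for p
  proof -
    have "f = g / U \<longleftrightarrow> f * U = g" for f g
    proof
      show "f * U = g" if "f = g / U"
        using that U0 by (simp add: fps_divide_unit mult.assoc inverse_mult_eq_1)
      show "f = g / U" if "f * U = g"
        unfolding that[symmetric] using U0 by (simp add: fps_divide_unit mult.assoc inverse_mult_eq_1')
    qed
    then show ?thesis
      using ehrhart_series_Q by (auto simp: U_def fps_of_poly_eq_iff)
  qed
  show ?thesis
    unfolding delta_poly_def card_index using eq by (simp add: U_def)
qed

section \<open>The triangulation of the simplex\<close>

theorem Q_triangulation:
  "\<exists>T. lattice_triangulation_of T (Q c (Suc d)) \<and> regular T \<and> flag T \<and> unimodular T"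
proof -
  define V where "V = point 1 ` words d"
  define E where "E p q \<longleftrightarrow> (\<exists>B\<in>words d. \<exists>C\<in>words d. p = point 1 B \<and> q = point 1 C \<and> compat B C)" for p q
  obtain H where H: "\<And>B C. B \<in> words d \<Longrightarrow> C \<in> words d \<Longrightarrow> \<not> compat B C \<Longrightarrow> swaps d H B C"
    using swapping_height_exists by blast
  define h where "h p = real_of_int (H (the_inv_into (words d) (point 1) p))" for p
  have h_point: "h (point 1 B) = real_of_int (H B)" if "B \<in> words d" for B
    using the_inv_into_f_f[OF inj_point that] by (simp add: h_def)
  have E_point: "E (point 1 B) (point 1 C) \<longleftrightarrow> compat B C" if "B \<in> words d" "C \<in> words d" for B C
    using that inj_onD[OF inj_point] by (auto simp: E_def)
  interpret regular_flag V E h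
  proof
    show "finite V" by (simp add: V_def)
    show "E v v" if "v \<in> V" for v using that E_point by (auto simp: V_def)
    show "\<exists>u\<in>V. \<exists>u'\<in>V. u + u' = v + w \<and> h u + h u' < h v + h w"
      if vw: "v \<in> V" "w \<in> V" "\<not> E v w" for v w
    proof -
      obtain B C where BC: "B \<in> words d" "C \<in> words d" "v = point 1 B" "w = point 1 C"
        using vw by (auto simp: V_def)
      then have "\<not> compat B C" using E_point vw(3) by simp
      then obtain D D' where D: "D \<in> words d" "D' \<in> words d"
        "\<And>i. entry D i + entry D' i = entry B i + entry C i" "H D + H D' < H B + H C"
        using H[OF BC(1,2)] by (auto simp: swaps_def)
      have "real (entry D i) + real (entry D' i) = real (entry B i) + real (entry C i)" for i
        using D(3)[of i] by (simp flip: of_nat_add)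
      then have "point 1 D + point 1 D' = point 1 B + point 1 C"
        by (auto simp: point_def vec_eq_iff algebra_simps)
      moreover have "h (point 1 D) + h (point 1 D') < h (point 1 B) + h (point 1 C)"
        using D(4) h_point D(1,2) BC(1,2) by (simp flip: of_int_add)
      ultimately show ?thesis using D(1,2) BC(3,4) by (auto simp: V_def)
    qed
    fix a b :: "real ^ 'd \<Rightarrow> real" and v
    assume a: "\<And>v. v \<in> V \<Longrightarrow> 0 \<le> a v" and b: "\<And>v. v \<in> V \<Longrightarrow> 0 \<le> b v"
      and aE: "\<And>v w. v \<in> V \<Longrightarrow> w \<in> V \<Longrightarrow> 0 < a v \<Longrightarrow> 0 < a w \<Longrightarrow> E v w"
      and bE: "\<And>v w. v \<in> V \<Longrightarrow> w \<in> V \<Longrightarrow> 0 < b v \<Longrightarrow> 0 < b w \<Longrightarrow> E v w"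
      and s: "sum a V = sum b V" "(\<Sum>v\<in>V. a v *\<^sub>R v) = (\<Sum>v\<in>V. b v *\<^sub>R v)" and v: "v \<in> V"
    have mem: "point 1 B \<in> V" if "B \<in> words d" for B using that by (simp add: V_def)
    obtain B where B: "B \<in> words d" "v = point 1 B" using v by (auto simp: V_def)
    have sums: "(\<Sum>B\<in>words d. a (point 1 B)) = (\<Sum>B\<in>words d. b (point 1 B))"
      "(\<Sum>B\<in>words d. a (point 1 B) *\<^sub>R point 1 B) = (\<Sum>B\<in>words d. b (point 1 B) *\<^sub>R point 1 B)"
      using s inj_point by (simp_all add: V_def sum.reindex)
    show "a v = b v"
      unfolding B(2)
    proof (rule clique_combination_unique[where a = "\<lambda>B. a (point 1 B)" and b = "\<lambda>B. b (point 1 B)" and d = d])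
      show "compat B C" if "B \<in> words d" "C \<in> words d" "0 < a (point 1 B)" "0 < a (point 1 C)" for B C
        using aE[OF mem mem] E_point that by blast
      show "compat B C" if "B \<in> words d" "C \<in> words d" "0 < b (point 1 B)" "0 < b (point 1 C)" for B C
        using bE[OF mem mem] E_point that by blast
    qed (use a b mem sums B(1) point_combination_entries[OF sums] in auto)
  qed
  have "unimodular triangulation"
  proof (rule unimodular_triangulation)
    show "V \<subseteq> lattice_points" using point_lattice[of 1] by (auto simp: V_def)
    fix S i assume S: "S \<in> cliques" and mx: "\<And>S'. S' \<in> cliques \<Longrightarrow> S \<subseteq> S' \<Longrightarrow> S' = S"
    define S\<^sub>0 where "S\<^sub>0 = {B \<in> words d. point 1 B \<in> S}"
    have S_eq: "S = point 1 ` S\<^sub>0"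
      using cliques_subset[OF S] by (auto simp: S\<^sub>0_def V_def)
    have inj: "inj_on (point 1) S\<^sub>0" using inj_point by (rule inj_on_subset) (auto simp: S\<^sub>0_def)
    have "max_clique d S\<^sub>0"
      unfolding max_clique_def
    proof (intro conjI ballI impI)
      show "S\<^sub>0 \<subseteq> words d" by (auto simp: S\<^sub>0_def)
      show "compat B C" if "B \<in> S\<^sub>0" "C \<in> S\<^sub>0" for B C
        using that cliques_E[OF S] E_point by (auto simp: S\<^sub>0_def)
      fix B assume B: "B \<in> words d" "\<forall>C\<in>S\<^sub>0. compat B C"
      have "insert (point 1 B) S \<in> cliques"
        using S B E_point compat_commute unfolding cliques_def S_eq by (auto simp: V_def S\<^sub>0_def)
      then show "B \<in> S\<^sub>0" using mx[of "insert (point 1 B) S"] B(1) by (auto simp: S\<^sub>0_def)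
    qed
    \<comment> \<open>The prescribed values are the heights with \<open>t = 0\<close> of the unit
      vector \<open>axis i 1\<close>: position \<open>j\<close> of a word carries height number
      \<open>d - j\<close>, which is -1 from number \<open>c i\<close> on.\<close>
    then obtain b where b: "sum b S\<^sub>0 = 0"
      "\<And>j. j < d \<Longrightarrow> (\<Sum>B\<in>S\<^sub>0. b B * int (entry B j)) = (if c i \<le> d - j then -1 else 0)"
      using max_clique_generates[of d S\<^sub>0 0 "\<lambda>j. if c i \<le> d - j then -1 else 0"] by blast
    define b' where "b' v = real_of_int (b (the_inv_into S\<^sub>0 (point 1) v))" for v
    have b'_point: "b' (point 1 B) = real_of_int (b B)" if "B \<in> S\<^sub>0" for B
      using the_inv_into_f_f[OF inj that] by (simp add: b'_def)
    have sum0: "(\<Sum>B\<in>S\<^sub>0. real_of_int (b B)) = 0"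
      using b(1) by (simp flip: of_int_sum)
    have "(\<Sum>B\<in>S\<^sub>0. real_of_int (b B) *\<^sub>R point 1 B) = axis i 1"
    proof (rule height_inject[of 0])
      fix k assume k: "k \<le> d"
      have "height 0 (\<Sum>B\<in>S\<^sub>0. real_of_int (b B) *\<^sub>R point 1 B) k = (\<Sum>B\<in>S\<^sub>0. real_of_int (b B) * height 1 (point 1 B) k)"
        using height_sum[of "\<lambda>B. real_of_int (b B)" S\<^sub>0 "point 1" k] sum0 by simp
      also have "\<dots> = (\<Sum>B\<in>S\<^sub>0. real_of_int (b B) * real (entry B (d - k)))"
        using k by (intro sum.cong) (auto simp: S\<^sub>0_def height_point_1)
      also have "\<dots> = real_of_int (\<Sum>B\<in>S\<^sub>0. b B * int (entry B (d - k)))" by simp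
      also have "\<dots> = (if c i \<le> k then -1 else 0)"
      proof (cases "k = 0")
        case True
        have "entry B d = 0" if "B \<in> S\<^sub>0" for B
          using that by (auto simp: S\<^sub>0_def words_def intro: entry_beyond)
        then show ?thesis using True c_mem[of i] by simp
      next
        case False
        then show ?thesis using b(2)[of "d - k"] k by simp
      qed
      also have "\<dots> = height 0 (axis i 1) k"
      proof -
        have "height 0 (axis i 1) k = (\<Sum>j=1..k. if j = c i then -1 else 0)"
          unfolding height_def using k by (intro sum.cong) (auto simp: axis_def)
        then show ?thesis using c_mem[of i] by simp
      qed
      finally show "height 0 (\<Sum>B\<in>S\<^sub>0. real_of_int (b B) *\<^sub>R point 1 B) k = height 0 (axis i 1) k" .
    qed
    then have "(\<Sum>v\<in>S. b' v *\<^sub>R v) = axis i 1" "sum b' S = 0"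
      using sum0 b'_point inj unfolding S_eq by (simp_all add: sum.reindex)
    moreover have "S \<noteq> {}"
      using mx[OF singleton_clique[of "point 1 []"]] by (auto simp: V_def)
    ultimately show "S \<noteq> {} \<and> (\<exists>b. (\<forall>v\<in>S. b v \<in> \<int>) \<and> sum b S = 0 \<and> (\<Sum>v\<in>S. b v *\<^sub>R v) = axis i 1)"
      by (auto simp: b'_def intro!: exI[of _ b'])
  qed
  moreover have "lattice_triangulation_of triangulation (Q c (Suc d))"
    unfolding lattice_triangulation_of_def
    using simplicial_complex_triangulation Union_triangulation vertex_set_triangulation
      hull_points point_lattice[of 1] by (auto simp: V_def)
  ultimately show ?thesis
    using regular_triangulation flag_triangulation by blast
qed

end

theorem theorem3:
  fixes n :: nat and c :: "'d::finite \<Rightarrow> nat"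
  assumes "n \<ge> 2"
    and "bij_betw c (UNIV :: 'd set) {1..n - 1}"
  shows "lattice_polytope (Q c n) \<and> (int n - 1) simplex (Q c n)
       \<and> delta_poly (Q c n) = eulerian_poly n
       \<and> (\<exists>T. lattice_triangulation_of T (Q c n) \<and> regular T \<and> flag T \<and> unimodular T)"
proof -
  interpret coordinate_numbering c "n - 1"
    using assms(2) by unfold_locales
  have n: "Suc (n - 1) = n" "int (n - 1) = int n - 1" using assms(1) by auto
  show ?thesis
    using Q_lattice_polytope Q_simplex delta_poly_Q Q_triangulation unfolding n by blast
qed

end
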